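(* Let $\Bbbk$ be a field of characteristic zero and let $P_1,P_2\in\Bbbk[z]$ be monic polynomials with $P_1(0)=1=P_2(0)$. For any $m\ge 0$, the elements $X_m,Y_m\in\mathbb{K}=\Bbbk(X,Y)$ given by $$X_m:=F_{P_1}F_{P_2}\cdots F_{P_m}(X)\quad\text{and}\quad Y_m:=F_{P_1}F_{P_2}\cdots F_{P_m}(Y)$$ (with $X_0=X$, $Y_0=Y$) are contained in the semiring $\mathbb{A}_+\langle X^{\pm1},Y^{\pm1}\rangle\subset\mathbb{K}$ of pseudo-positive non-commutative Laurent polynomials.
   Context: $\mathbb{K}=\Bbbk(X,Y)$ is the skew-field of rational functions in two non-commuting variables $X,Y$ (the free skew-field over $\Bbbk$). For a nonzero polynomial $P\in\Bbbk[z]$, $F_P$ is the $\Bbbk$-linear (skew-field) automorphism of $\mathbb{K}$ determined by $F_P(X)=XYX^{-1}$ and $F_P(Y)=P(Y)X^{-1}$. Products of the $F_P$ denote composition, so $F_{P_1}F_{P_2}(Y)=F_{P_1}(F_{P_2}(Y))$. Let $d_i=\deg P_i$ and write $P_i(z)=\sum_{j=0}^{d_i}p_{i,j}z^j$ for $i=1,2$, so $p_{i,0}=p_{i,d_i}=1$. Put $\bar P_i(z)=z^{d_i}P_i(z^{-1})$. For every $k\in\mathbb{Z}$ set $P_k=\bar P_2$ if $k\equiv0$, $P_k=P_1$ if $k\equiv 1$, $P_k=P_2$ if $k\equiv 2$, $P_k=\bar P_1$ if $k\equiv 3$ modulo $4$. $\mathbb{A}_+=\mathbb{Z}_{\ge0}[p_{1,i},p_{2,j}:0\le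 i\le d_1,0\le j\le d_2]\subset\Bbbk$ is the sub-semiring generated by the coefficients, and $\mathbb{A}_+\langle X^{\pm1},Y^{\pm1}\rangle$ is the set of finite sums of elements $a\cdot w$ with $a\in\mathbb{A}_+$ and $w$ a word in $X,X^{-1},Y,Y^{-1}$. *)

theory Defs
  imports "HOL-Algebra.Ring" "HOL-Computational_Algebra.Polynomial"
begin

definition type_ring :: "'a::ring_1 ring" where
  "type_ring = \<lparr>carrier = UNIV, monoid.mult = (*), one = 1, zero = 0, add = (+)\<rparr>"

definition skew_field :: "'a ring \<Rightarrow> bool" where
  "skew_field D \<longleftrightarrow> ring D \<and> \<one>\<^bsub>D\<^esub> \<noteq> \<zero>\<^bsub>D\<^esub> \<and> Units D = carrier D - {\<zero>\<^bsub>D\<^esub>}"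

text \<open>A \<open>\<Bbbk>\<close>-algebra structure on \<open>D\<close> is given by its structure map, a central ring
  homomorphism from \<open>\<Bbbk>\<close> to \<open>D\<close>.\<close>

definition algebra_map :: "('k::field \<Rightarrow> 'a) \<Rightarrow> 'a ring \<Rightarrow> bool" where
  "algebra_map j D \<longleftrightarrow> j \<in> ring_hom type_ring D \<and>
     (\<forall>c. \<forall>x\<in>carrier D. j c \<otimes>\<^bsub>D\<^esub> x = x \<otimes>\<^bsub>D\<^esub> j c)"

definition generates_skew_field :: "('k \<Rightarrow> 'a::division_ring) \<Rightarrow> 'a \<Rightarrow> 'a \<Rightarrow> bool" where
  "generates_skew_field \<iota> X Y \<longleftrightarrow>
     (\<forall>S. range \<iota> \<subseteq> S \<and> X \<in> S \<and> Y \<in> S \<and>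
          (\<forall>x\<in>S. \<forall>y\<in>S. x - y \<in> S \<and> x * y \<in> S) \<and> (\<forall>x\<in>S. inverse x \<in> S)
        \<longrightarrow> S = UNIV)"

text \<open>A specialization in the sense of P. M. Cohn: a homomorphism \<open>f\<close> of
  \<open>\<Bbbk>\<langle>X,Y\<rangle>\<close>-rings from a subring \<open>L\<close> of the skew field \<open>'a\<close> to
  \<open>D\<close>, such that every element of \<open>L\<close> outside the kernel of \<open>f\<close> is invertible in
  \<open>L\<close>. The \<open>\<Bbbk>\<langle>X,Y\<rangle>\<close>-ring structure on \<open>D\<close> is given by the structure map
  \<open>j\<close> and the images \<open>a\<close>, \<open>b\<close> of \<open>X\<close>, \<open>Y\<close>.\<close>

definition has_specialization ::
    "('k \<Rightarrow> 'a::division_ring) \<Rightarrow> 'a \<Rightarrow> 'a \<Rightarrow> 'b ring \<Rightarrow> ('k \<Rightarrow> 'b) \<Rightarrow> 'b \<Rightarrow> 'b \<Rightarrow> bool" where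
  "has_specialization \<iota> X Y D j a b \<longleftrightarrow>
     (\<exists>L f. ring (type_ring\<lparr>carrier := L\<rparr>) \<and> range \<iota> \<subseteq> L \<and> X \<in> L \<and> Y \<in> L \<and>
        f \<in> ring_hom (type_ring\<lparr>carrier := L\<rparr>) D \<and>
        (\<forall>c. f (\<iota> c) = j c) \<and> f X = a \<and> f Y = b \<and>
        (\<forall>x\<in>L. f x \<noteq> \<zero>\<^bsub>D\<^esub> \<longrightarrow> inverse x \<in> L))"

text \<open>The free skew field \<open>\<Bbbk>(X,Y)\<close> is the universal field of fractions of the free algebra
  \<open>\<Bbbk>\<langle>X,Y\<rangle>\<close>: it is generated by \<open>\<Bbbk>\<close>, \<open>X\<close>, \<open>Y\<close> as a skew field
  and specializes to every skew field over \<open>\<Bbbk>\<close> with two chosen elements. It suffices to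
  consider skew fields \<open>D\<close> whose carrier is a set of elements of type \<open>'a\<close>: replacing \<open>D\<close>
  by its sub-skew-field generated by \<open>\<Bbbk>\<close>, \<open>a\<close>, \<open>b\<close>, its cardinality is at most
  the maximum of that of \<open>\<Bbbk>\<close> and countable infinity, hence at most that of the infinite
  type \<open>'a\<close>, so that it has an isomorphic copy inside \<open>'a\<close>. Injectivity of
  \<open>\<Bbbk>\<langle>X,Y\<rangle> \<rightarrow> 'a\<close> follows, since \<open>\<Bbbk>\<langle>X,Y\<rangle>\<close> embeds into some
  skew field.\<close>

definition free_skew_field :: "('k::field \<Rightarrow> 'a::division_ring) \<Rightarrow> 'a \<Rightarrow> 'a \<Rightarrow> bool" where
  "free_skew_field \<iota> X Y \<longleftrightarrow>
     algebra_map \<iota> type_ring \<and> generates_skew_field \<iota> X Y \<and>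
     (\<forall>(D :: 'a ring) j a b.
        skew_field D \<and> algebra_map j D \<and> a \<in> carrier D \<and> b \<in> carrier D
        \<longrightarrow> has_specialization \<iota> X Y D j a b)"

definition poly_at :: "('k::zero \<Rightarrow> 'a::ring_1) \<Rightarrow> 'k poly \<Rightarrow> 'a \<Rightarrow> 'a" where
  "poly_at \<iota> P y = (\<Sum>i\<le>degree P. \<iota> (coeff P i) * y ^ i)"

definition linear_automorphism :: "('k \<Rightarrow> 'a::division_ring) \<Rightarrow> ('a \<Rightarrow> 'a) \<Rightarrow> bool" where
  "linear_automorphism \<iota> \<phi> \<longleftrightarrow> \<phi> \<in> ring_hom type_ring type_ring \<and> bij \<phi> \<and>
     (\<forall>c x. \<phi> (\<iota> c * x) = \<iota> c * \<phi> x)"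

definition F :: "('k::field \<Rightarrow> 'a::division_ring) \<Rightarrow> 'a \<Rightarrow> 'a \<Rightarrow> 'k poly \<Rightarrow> 'a \<Rightarrow> 'a" where
  "F \<iota> X Y P = (THE \<phi>. linear_automorphism \<iota> \<phi> \<and>
     \<phi> X = X * Y * inverse X \<and> \<phi> Y = poly_at \<iota> P Y * inverse X)"

text \<open>Since \<open>P\<^sub>i(0) \<noteq> 0\<close>, \<^const>\<open>reflect_poly\<close> of \<open>P\<^sub>i\<close> is
  \<open>z ^ deg P\<^sub>i * P\<^sub>i(1/z)\<close>.\<close>

definition P_seq :: "'k::field poly \<Rightarrow> 'k poly \<Rightarrow> int \<Rightarrow> 'k poly" where
  "P_seq P1 P2 k =
     (if k mod 4 = 0 then reflect_poly P2
      else if k mod 4 = 1 then P1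
      else if k mod 4 = 2 then P2
      else reflect_poly P1)"

primrec F_comp ::
    "('k::field \<Rightarrow> 'a::division_ring) \<Rightarrow> 'a \<Rightarrow> 'a \<Rightarrow> 'k poly \<Rightarrow> 'k poly \<Rightarrow> nat \<Rightarrow> 'a \<Rightarrow> 'a" where
  "F_comp \<iota> X Y P1 P2 0 = id"
| "F_comp \<iota> X Y P1 P2 (Suc m) =
     F_comp \<iota> X Y P1 P2 m \<circ> F \<iota> X Y (P_seq P1 P2 (int (Suc m)))"

inductive_set A_plus :: "'k::field poly \<Rightarrow> 'k poly \<Rightarrow> 'k set" for P1 P2 where
  zero: "0 \<in> A_plus P1 P2"
| one: "1 \<in> A_plus P1 P2"
| coeff1: "i \<le> degree P1 \<Longrightarrow> coeff P1 i \<in> A_plus P1 P2"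
| coeff2: "j \<le> degree P2 \<Longrightarrow> coeff P2 j \<in> A_plus P1 P2"
| add: "a \<in> A_plus P1 P2 \<Longrightarrow> b \<in> A_plus P1 P2 \<Longrightarrow> a + b \<in> A_plus P1 P2"
| mult: "a \<in> A_plus P1 P2 \<Longrightarrow> b \<in> A_plus P1 P2 \<Longrightarrow> a * b \<in> A_plus P1 P2"

definition laurent_words :: "'a::division_ring \<Rightarrow> 'a \<Rightarrow> 'a set" where
  "laurent_words X Y = {prod_list ws | ws. set ws \<subseteq> {X, inverse X, Y, inverse Y}}"

definition laurent_semiring ::
    "('k \<Rightarrow> 'a::division_ring) \<Rightarrow> 'k set \<Rightarrow> 'a \<Rightarrow> 'a \<Rightarrow> 'a set" where
  "laurent_semiring \<iota> A X Y =
     {(\<Sum>(a, w)\<leftarrow>ts. \<iota> a * w) | ts. set ts \<subseteq> A \<times> laurent_words X Y}"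

end

(* Let x, y stand for X, Y and consider formal words in X, x = X^-1, y = Y, Y^-1 modulo the
rules x X = 1, y Y^-1 = 1, y X = 0 (and no others). The left-hand sides do not overlap, so every
formal word has a unique normal form: a word in X^{+-1}, Y^{+-1}, or 0. For polynomials A, B put
H = x A(y) and V = B(X) Y^-1, and for a word w in h, v ("path") let path_sum A B w be the value
in the skew field of the normal form of the corresponding product of H's and V's; it is a
pseudo-positive Laurent polynomial. The claim is Y_m = X (path_sum P_1 (bar P_2) w_m) X^-1 for
paths w_m with an explicit recursion.

To apply F_Q to the path sum of h v^c_1 h v^c_2 ... (with polynomials P and Q), expand
h = x P(y) only. In words in x, y and W = Q(X) Y^-1 the one relation
  y x^s W = sum_{l <= s} q_l y x^(s-l) Y^-1
is matched, under X^-1 F_Q( ) X : x -> Y^-1, y -> H = x Q(y), W -> X, by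
  H Y^-s X = sum_{l <= s} q_l x Y^-(s-l) X,
and words containing no y x^s W are already normal on either side. Hence the automorphism commutes
with taking normal forms. Since H X = 1, we have H^i X^c = H^(d-c) X^(d-i) with d = deg P, so the
image is again a path sum, of h^(d-c_1) v h^(d-c_2) v ..., with polynomials Q and bar P.

The exponents d - c_j stay nonnegative if deg P_1 * deg P_2 >= 4. In the remaining cases
the sequence is periodic up to conjugation by the commutator of X and Y, or one degree is 0 and
four steps of the recursion send X and Y to words. *)
theory Submission
  imports Defs
begin

subsection \<open>Formal words\<close>

text \<open>\<open>XP\<close>, \<open>XM\<close>, \<open>YP\<close>, \<open>YM\<close> stand for \<open>X\<close>, \<open>X\<^sup>-\<^sup>1\<close>, \<open>Y\<close>, \<open>Y\<^sup>-\<^sup>1\<close>; \<^term>\<open>push a r\<close> is the normal form of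
  \<open>a # r\<close> for a normal word \<open>r\<close>, with \<open>None\<close> for the zero of the algebra.\<close>

datatype sym = XP | XM | YP | YM

fun push :: "sym \<Rightarrow> sym list \<Rightarrow> sym list option" where
  "push XP r = Some (XP # r)"
| "push YM r = Some (YM # r)"
| "push XM [] = Some [XM]"
| "push XM (a # r) = (if a = XP then Some r else Some (XM # a # r))"
| "push YP [] = Some [YP]"
| "push YP (a # r) = (if a = YM then Some r else if a = XP then None else Some (YP # a # r))"

text \<open>Formal sums of words are represented by the dual operators on functions of normal words. The
  product \<open>A B\<close> therefore acts as \<open>\<lambda>f. B (A f)\<close>.\<close>

definition ins :: "sym \<Rightarrow> (sym list \<Rightarrow> 'a::zero) \<Rightarrow> sym list \<Rightarrow> 'a" where
  "ins a f r = (case push a r of None \<Rightarrow> 0 | Some r' \<Rightarrow> f r')"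

lemma ins_simps [simp]:
  "ins XM f (XP # r) = f r" "ins YP f (YM # r) = f r" "ins YP f (XP # r) = 0"
  "ins XP f r = f (XP # r)" "ins YM f r = f (YM # r)"
  by (simp_all add: ins_def)

text \<open>No rule has \<open>XM\<close> as its second letter, so a trailing \<open>XM\<close>
  never takes part in a reduction.\<close>

lemma push_snoc: "push a (r @ [XM]) = map_option (\<lambda>r. r @ [XM]) (push a r)"
  by (cases a; cases r) auto

text \<open>The letters \<open>x\<close>, \<open>y\<close>, \<open>W\<close> and the words \<open>y x\<^bsup>n+1\<^esup> Y\<^sup>-\<^sup>1\<close> (\<open>Lr n\<close>) produced by the relation between them.\<close>

datatype letter = Lx | Ly | Lw | Lr nat

primrec word_op :: "(letter \<Rightarrow> 'b \<Rightarrow> 'b) \<Rightarrow> letter list \<Rightarrow> 'b \<Rightarrow> 'b" where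
  "word_op opr [] f = f"
| "word_op opr (a # u) f = word_op opr u (opr a f)"

lemma word_op_append: "word_op opr (u @ v) f = word_op opr v (word_op opr u f)"
  by (induction u arbitrary: f) auto

lemma word_op_replicate: "word_op opr (replicate n a) f = (opr a ^^ n) f"
  by (induction n arbitrary: f) (auto simp: funpow_swap1)

text \<open>A word fails \<open>no_w\<close> exactly when it begins with x^s W. Hence
  \<open>terminal\<close> words are those without a factor y x^s W, the only factor to which the
  relation applies.\<close>

fun no_w :: "letter list \<Rightarrow> bool" where
  "no_w [] = True"
| "no_w (Lx # u) = no_w u"
| "no_w (Lw # u) = False"
| "no_w (_ # u) = True"

fun terminal :: "letter list \<Rightarrow> bool" where
  "terminal [] = True"
| "terminal (Ly # u) = (no_w u \<and> terminal u)"
| "terminal (_ # u) = terminal u"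

lemma not_no_w: "\<not> no_w u \<Longrightarrow> \<exists>s v. u = replicate s Lx @ Lw # v"
proof (induction u rule: no_w.induct)
  case (2 u)
  then obtain s v where "u = replicate s Lx @ Lw # v" by auto
  then have "Lx # u = replicate (Suc s) Lx @ Lw # v" by simp
  then show ?case by blast
next
  case (3 u)
  have "Lw # u = replicate 0 Lx @ Lw # u" by simp
  then show ?case by blast
qed auto

lemma not_terminal: "\<not> terminal u \<Longrightarrow> \<exists>u1 s u2. u = u1 @ Ly # replicate s Lx @ Lw # u2"
proof (induction u)
  case (Cons a u)
  show ?case
  proof (cases "terminal u")
    case True
    with Cons.prems have "a = Ly" "\<not> no_w u" by (cases a; simp)+
    moreover from not_no_w[OF this(2)] obtain s v where "u = replicate s Lx @ Lw # v" by blast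
    ultimately have "a # u = [] @ Ly # replicate s Lx @ Lw # v" by simp
    then show ?thesis by blast
  next
    case False
    with Cons.IH obtain u1 s u2 where "a # u = (a # u1) @ Ly # replicate s Lx @ Lw # u2" by auto
    then show ?thesis by blast
  qed
qed simp

subsection \<open>Evaluation of formal sums in the skew field\<close>

text \<open>The word calculus takes place over any skew field with central scalars and two nonzero
  elements; freeness enters later, through \<open>free_generators\<close>.\<close>

locale two_generators =
  fixes \<iota> :: "'k::field \<Rightarrow> 'a::division_ring" and X Y :: 'a
  assumes \<iota>_one: "\<iota> 1 = 1"
    and \<iota>_add: "\<iota> (a + b) = \<iota> a + \<iota> b"
    and \<iota>_mult: "\<iota> (a * b) = \<iota> a * \<iota> b"
    and \<iota>_central: "\<iota> c * z = z * \<iota> c"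
    and X_nz: "X \<noteq> 0" and Y_nz: "Y \<noteq> 0"
begin

lemma \<iota>_zero: "\<iota> 0 = 0"
  using \<iota>_add[of 0 0] by simp

lemma \<iota>_left: "z * (\<iota> c * t) = \<iota> c * (z * t)"
proof -
  have "z * (\<iota> c * t) = (z * \<iota> c) * t" by (simp only: mult.assoc)
  also have "\<dots> = \<iota> c * (z * t)" by (simp only: \<iota>_central[of c z, symmetric] mult.assoc)
  finally show ?thesis .
qed

primrec sval :: "sym \<Rightarrow> 'a" where
  "sval XP = X" | "sval XM = inverse X" | "sval YP = Y" | "sval YM = inverse Y"

primrec ev :: "sym list \<Rightarrow> 'a" where
  "ev [] = 1" | "ev (a # r) = sval a * ev r"

lemma ev_append: "ev (r @ t) = ev r * ev t"
  by (induction r) (auto simp: mult.assoc)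

lemma ev_push: "push a r = Some r' \<Longrightarrow> ev r' = sval a * ev r"
  by (induction a r rule: push.induct)
     (auto simp: mult.assoc[symmetric] X_nz Y_nz split: if_splits)

definition poly_op :: "'k poly \<Rightarrow> sym \<Rightarrow> (sym list \<Rightarrow> 'a) \<Rightarrow> sym list \<Rightarrow> 'a" where
  "poly_op P a f r = (\<Sum>l\<le>degree P. \<iota> (coeff P l) * (ins a ^^ l) f r)"

definition H :: "'k poly \<Rightarrow> (sym list \<Rightarrow> 'a) \<Rightarrow> sym list \<Rightarrow> 'a" where
  "H Q f = poly_op Q YP (ins XM f)"

definition V :: "'k poly \<Rightarrow> (sym list \<Rightarrow> 'a) \<Rightarrow> sym list \<Rightarrow> 'a" where
  "V P f = ins YM (poly_op P XP f)"

text \<open>Two-sided linearity over the skew field, together with inertness of a trailing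
  \<open>XM\<close>. Operators built from \<open>ins\<close> with central coefficients have these
  properties, so products can be expanded term by term although the values do not commute.\<close>

definition nice :: "((sym list \<Rightarrow> 'a) \<Rightarrow> sym list \<Rightarrow> 'a) \<Rightarrow> bool" where
  "nice A \<longleftrightarrow> (\<forall>f g. A (\<lambda>r. f r + g r) = (\<lambda>r. A f r + A g r)) \<and>
     (\<forall>c f. A (\<lambda>r. c * f r) = (\<lambda>r. c * A f r)) \<and>
     (\<forall>c f. A (\<lambda>r. f r * c) = (\<lambda>r. A f r * c)) \<and>
     (\<forall>f r. A f (r @ [XM]) = A (\<lambda>r. f (r @ [XM])) r)"

lemma nice_add: "nice A \<Longrightarrow> A (\<lambda>r. f r + g r) r = A f r + A g r"
  and nice_left: "nice A \<Longrightarrow> A (\<lambda>r. c * f r) r = c * A f r"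
  and nice_right: "nice A \<Longrightarrow> A (\<lambda>r. f r * c) r = A f r * c"
  and nice_snoc: "nice A \<Longrightarrow> A f (r @ [XM]) = A (\<lambda>r. f (r @ [XM])) r"
  unfolding nice_def by simp_all

lemma nice_zero: "nice A \<Longrightarrow> A (\<lambda>r. 0) r = 0"
  using nice_left[of A 0 "\<lambda>r. 0" r] by simp

lemma nice_sum:
  assumes "nice A" "finite I"
  shows "A (\<lambda>r. \<Sum>i\<in>I. f i r) r = (\<Sum>i\<in>I. A (f i) r)"
  using assms(2)
proof (induction I rule: finite_induct)
  case empty
  then show ?case using nice_zero[OF assms(1)] by simp
next
  case (insert i I)
  then show ?case using nice_add[OF assms(1), of "f i" "\<lambda>r. \<Sum>i\<in>I. f i r"] by simp
qed

lemma nice_comb: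
  assumes "nice A" "finite I"
  shows "A (\<lambda>r. \<Sum>i\<in>I. c i * f i r) r = (\<Sum>i\<in>I. c i * A (f i) r)"
  using nice_sum[OF assms, of "\<lambda>i r. c i * f i r" r] nice_left[OF assms(1)] by simp

lemma nice_ins: "nice (ins a)"
  unfolding nice_def ins_def push_snoc by (auto simp: fun_eq_iff split: option.splits)

lemma nice_id: "nice (\<lambda>f. f)"
  unfolding nice_def by auto

lemma nice_comp: "nice A \<Longrightarrow> nice B \<Longrightarrow> nice (\<lambda>f. B (A f))"
  unfolding nice_def by simp

lemma nice_funpow: "nice A \<Longrightarrow> nice (A ^^ n)"
  by (induction n) (simp_all add: nice_id id_def o_def nice_comp)

lemma nice_scaled_sum:
  assumes "\<And>i. nice (A i)"
  shows "nice (\<lambda>f r. \<Sum>i\<in>I. \<iota> (c i) * A i f r)"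
  unfolding nice_def
proof (intro conjI allI ext)
  fix f g r
  show "(\<Sum>i\<in>I. \<iota> (c i) * A i (\<lambda>r. f r + g r) r)
      = (\<Sum>i\<in>I. \<iota> (c i) * A i f r) + (\<Sum>i\<in>I. \<iota> (c i) * A i g r)"
    by (simp add: nice_add[OF assms] sum.distrib distrib_left)
next
  fix z f r
  show "(\<Sum>i\<in>I. \<iota> (c i) * A i (\<lambda>r. z * f r) r) = z * (\<Sum>i\<in>I. \<iota> (c i) * A i f r)"
    by (simp add: nice_left[OF assms] sum_distrib_left \<iota>_left[of z])
next
  fix z f r
  show "(\<Sum>i\<in>I. \<iota> (c i) * A i (\<lambda>r. f r * z) r) = (\<Sum>i\<in>I. \<iota> (c i) * A i f r) * z"
    by (simp add: nice_right[OF assms] sum_distrib_right mult.assoc)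
next
  fix f r
  show "(\<Sum>i\<in>I. \<iota> (c i) * A i f (r @ [XM])) = (\<Sum>i\<in>I. \<iota> (c i) * A i (\<lambda>r. f (r @ [XM])) r)"
    by (simp add: nice_snoc[OF assms])
qed

lemma nice_poly_op: "nice (poly_op P a)"
  unfolding poly_op_def[abs_def] by (rule nice_scaled_sum) (rule nice_funpow[OF nice_ins])

lemma nice_H: "nice (H Q)" and nice_V: "nice (V Q)"
  unfolding H_def[abs_def] V_def[abs_def]
  by (rule nice_comp[OF nice_ins nice_poly_op], rule nice_comp[OF nice_poly_op nice_ins])

section \<open>Normal forms of powers acting on words\<close>

lemma funpow_ins_creator:
  assumes "\<And>r. push a r = Some (a # r)"
  shows "(ins a ^^ n) f r = f (replicate n a @ r)"
  by (induction n arbitrary: r) (auto simp: ins_def assms replicate_app_Cons_same)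

lemma XP_pow: "(ins XP ^^ n) f r = f (replicate n XP @ r)"
  and YM_pow: "(ins YM ^^ n) f r = f (replicate n YM @ r)"
  by (rule funpow_ins_creator, simp)+

lemma pop_YM: "(ins YP ^^ l) f (replicate s YM @ r) =
    (if l \<le> s then f (replicate (s - l) YM @ r) else (ins YP ^^ (l - s)) f r)"
proof (induction s arbitrary: l)
  case (Suc s)
  show ?case by (cases l) (simp_all add: Suc.IH)
qed auto

lemma pop_XP: "(ins XM ^^ l) f (replicate s XP @ r) =
    (if l \<le> s then f (replicate (s - l) XP @ r) else (ins XM ^^ (l - s)) f r)"
proof (induction s arbitrary: l)
  case (Suc s)
  show ?case by (cases l) (simp_all add: Suc.IH)
qed auto

text \<open>The rule y X = 0 applies to the last factor y. This truncates the relation below and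
  yields H X = 1.\<close>

lemma YP_kill: "n > 0 \<Longrightarrow> (ins YP ^^ n) f (XP # r) = 0"
  by (cases n) auto

lemma ins_XM_stay: "r = [] \<or> hd r \<noteq> XP \<Longrightarrow> ins XM f r = f (XM # r)"
  by (cases r) (auto simp: ins_def)

lemma XM_pow_stay: "r = [] \<or> hd r \<noteq> XP \<Longrightarrow> (ins XM ^^ n) f r = f (replicate n XM @ r)"
proof (induction n arbitrary: r)
  case (Suc n)
  have "(ins XM ^^ Suc n) f r = (ins XM ^^ n) f (XM # r)"
    using Suc.prems by (simp add: ins_XM_stay)
  also have "\<dots> = f (replicate (Suc n) XM @ r)"
    by (subst Suc.IH) (simp_all add: replicate_app_Cons_same)
  finally show ?case .
qed simp

lemma YP_pow_stay: "r = [] \<or> hd r \<notin> {XP, YM} \<Longrightarrow> (ins YP ^^ n) f r = f (replicate n YP @ r)"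
proof (induction n arbitrary: r)
  case (Suc n)
  have "(ins YP ^^ Suc n) f r = (ins YP ^^ n) f (YP # r)"
    using Suc.prems by (cases r) (auto simp: ins_def)
  also have "\<dots> = f (replicate (Suc n) YP @ r)"
    by (subst Suc.IH) (simp_all add: replicate_app_Cons_same)
  finally show ?case .
qed simp

subsection \<open>Normal forms commute with the automorphism\<close>

primrec src :: "'k poly \<Rightarrow> letter \<Rightarrow> (sym list \<Rightarrow> 'a) \<Rightarrow> sym list \<Rightarrow> 'a" where
  "src Q Lx = ins XM"
| "src Q Ly = ins YP"
| "src Q Lw = V Q"
| "src Q (Lr n) = (\<lambda>f. ins YM ((ins XM ^^ Suc n) (ins YP f)))"

text \<open>Formal counterparts of the images of the letters under conjugation by X after
  \<open>F\<close>. The word y x^(n+1) Y^-1 becomes x Y^-(n+1) X because Q(Y) commutes with Y and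
  cancels against its inverse.\<close>

primrec tgt :: "'k poly \<Rightarrow> letter \<Rightarrow> (sym list \<Rightarrow> 'a) \<Rightarrow> sym list \<Rightarrow> 'a" where
  "tgt Q Lx = ins YM"
| "tgt Q Ly = H Q"
| "tgt Q Lw = ins XP"
| "tgt Q (Lr n) = (\<lambda>f. ins XP ((ins YM ^^ Suc n) (ins XM f)))"

lemma nice_src: "nice (src Q a)" and nice_tgt: "nice (tgt Q a)"
proof -
  have *: "nice (\<lambda>f. ins b ((ins c ^^ n) (ins d f)))" for b c d n
    by (rule nice_comp[OF nice_comp[OF nice_ins nice_funpow[OF nice_ins]] nice_ins])
  show "nice (src Q a)" "nice (tgt Q a)"
    by (cases a; simp only: src.simps tgt.simps * nice_ins nice_V nice_H)+
qed

lemma nice_word_op: "(\<And>a. nice (opr a)) \<Longrightarrow> nice (word_op opr u)"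
proof (induction u)
  case Nil
  then show ?case by (simp add: nice_def)
next
  case (Cons a u)
  then show ?case using nice_comp[of "opr a" "word_op opr u"] by (simp add: fun_eq_iff nice_def)
qed

text \<open>The residual word y x^n Y^-1; for n = 0 the rule y Y^-1 = 1 leaves the empty
  word.\<close>

definition r_word :: "nat \<Rightarrow> letter list" where
  "r_word n = (case n of 0 \<Rightarrow> [] | Suc k \<Rightarrow> [Lr k])"

text \<open>In y x^s X^l Y^-1 the powers of X cancel. If l > s, an X survives directly behind y and
  the term is 0, hence the default coefficient 0.\<close>

lemma src_reduce:
  "word_op (src Q) (Ly # replicate s Lx @ [Lw]) f =
     (\<lambda>r. \<Sum>l\<le>degree Q. (if l \<le> s then \<iota> (coeff Q l) else 0) * word_op (src Q) (r_word (s - l)) f r)"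
proof
  fix r
  have *: "(ins XM ^^ s) (ins YP f) (replicate l XP @ YM # r) =
      (if l \<le> s then word_op (src Q) (r_word (s - l)) f r else 0)" for l
  proof (cases "s - l")
    case 0
    then show ?thesis
      by (cases "l - s") (auto simp: pop_XP r_word_def)
  next
    case (Suc k)
    then show ?thesis
      by (auto simp: pop_XP r_word_def simp del: funpow.simps)
  qed
  show "word_op (src Q) (Ly # replicate s Lx @ [Lw]) f r = (\<Sum>l\<le>degree Q.
      (if l \<le> s then \<iota> (coeff Q l) else 0) * word_op (src Q) (r_word (s - l)) f r)"
    by (auto simp: word_op_append word_op_replicate V_def poly_op_def XP_pow *
        intro!: sum.cong)
qed

text \<open>Here y^l cancels against Y^-s, and for l > s a positive power of y meets X and gives 0.
  Coefficients and residual words agree with those of \<open>src_reduce\<close>, so one rewriting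
  serves both sides.\<close>

lemma tgt_reduce:
  "word_op (tgt Q) (Ly # replicate s Lx @ [Lw]) f =
     (\<lambda>r. \<Sum>l\<le>degree Q. (if l \<le> s then \<iota> (coeff Q l) else 0) * word_op (tgt Q) (r_word (s - l)) f r)"
proof
  fix r
  have *: "(ins YP ^^ l) (ins XM f) (replicate s YM @ XP # r) =
      (if l \<le> s then word_op (tgt Q) (r_word (s - l)) f r else 0)" for l
  proof (cases "s - l")
    case 0
    then show ?thesis
      by (cases "l - s") (auto simp: pop_YM r_word_def)
  next
    case (Suc k)
    then show ?thesis
      by (auto simp: pop_YM r_word_def YM_pow simp del: funpow.simps)
  qed
  show "word_op (tgt Q) (Ly # replicate s Lx @ [Lw]) f r = (\<Sum>l\<le>degree Q.
      (if l \<le> s then \<iota> (coeff Q l) else 0) * word_op (tgt Q) (r_word (s - l)) f r)"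
    by (auto simp: word_op_append word_op_replicate H_def poly_op_def YM_pow *
        intro!: sum.cong)
qed

text \<open>\<open>reach u\<close> contains all normal words that can occur when the terminal word \<open>u\<close> is applied to
  the empty word.\<close>

definition local_op :: "(letter list \<Rightarrow> sym list set) \<Rightarrow>
    (letter \<Rightarrow> (sym list \<Rightarrow> 'a) \<Rightarrow> sym list \<Rightarrow> 'a) \<Rightarrow> bool" where
  "local_op reach opr \<longleftrightarrow> [] \<in> reach [] \<and>
     (\<forall>a u f g. terminal (a # u) \<longrightarrow> (\<forall>r\<in>reach (a # u). f r = g r) \<longrightarrow>
        (\<forall>r\<in>reach u. opr a f r = opr a g r))"

lemma word_op_cong:
  assumes "local_op reach opr"
  shows "\<lbrakk>terminal u; \<forall>r\<in>reach u. f r = g r\<rbrakk> \<Longrightarrow> word_op opr u f [] = word_op opr u g []"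
proof (induction u arbitrary: f g)
  case Nil
  then show ?case using assms by (auto simp: local_op_def)
next
  case (Cons a u)
  have "terminal u" using Cons.prems(1) by (cases a) auto
  moreover have "\<forall>r\<in>reach u. opr a f r = opr a g r"
    using assms Cons.prems unfolding local_op_def by blast
  ultimately show ?case using Cons.IH[of "opr a f" "opr a g"] by simp
qed

text \<open>By locality only words in \<open>reach\<close> matter; on these each letter acts on
  \<open>ev\<close> as left multiplication by its value, and linearity pulls this factor to the
  front.\<close>

lemma word_op_terminal:
  assumes local: "local_op reach opr"
    and val: "\<And>a u r. \<lbrakk>terminal (a # u); r \<in> reach u\<rbrakk> \<Longrightarrow> opr a ev r = v a * ev r"
    and nice: "\<And>a. nice (opr a)"
  shows "terminal u \<Longrightarrow> word_op opr u ev [] = prod_list (map v u)"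
proof (induction u)
  case (Cons a u)
  have t: "terminal u" using Cons.prems by (cases a) auto
  have "word_op opr (a # u) ev [] = word_op opr u (\<lambda>r. v a * ev r) []"
    using word_op_cong[OF local t, of "opr a ev" "\<lambda>r. v a * ev r"] val[OF Cons.prems] by simp
  also have "\<dots> = v a * word_op opr u ev []"
    by (rule nice_left[OF nice_word_op[OF nice]])
  finally show ?case using Cons.IH[OF t] by simp
qed simp

primrec src_val :: "'k poly \<Rightarrow> letter \<Rightarrow> 'a" where
  "src_val Q Lx = inverse X"
| "src_val Q Ly = Y"
| "src_val Q Lw = poly_at \<iota> Q X * inverse Y"
| "src_val Q (Lr n) = Y * inverse X ^ Suc n * inverse Y"

primrec tgt_val :: "'k poly \<Rightarrow> letter \<Rightarrow> 'a" where
  "tgt_val Q Lx = inverse Y"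
| "tgt_val Q Ly = inverse X * poly_at \<iota> Q Y"
| "tgt_val Q Lw = X"
| "tgt_val Q (Lr n) = inverse X * inverse Y ^ Suc n * X"

lemma ev_replicate: "ev (replicate n a) = sval a ^ n"
  by (induction n) auto

definition src_reach :: "letter list \<Rightarrow> sym list set" where
  "src_reach u = {r. no_w u \<longrightarrow> r = [] \<or> hd r \<notin> {XP, YM}}"

text \<open>Behind y, the operator x Q(y) must act as in the skew field. Powers of y may cancel
  Y^-s, the image of x^s, but must not meet X afterwards; so the rest is empty or starts with
  X^-1.\<close>

definition tgt_reach :: "letter list \<Rightarrow> sym list set" where
  "tgt_reach u = {r. no_w u \<longrightarrow> (\<exists>s r'. r = replicate s YM @ r' \<and> (r' = [] \<or> hd r' = XM))}"

lemma src_Ly: "r = [] \<or> hd r \<notin> {XP, YM} \<Longrightarrow> src Q Ly f r = f (YP # r)"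
  using YP_pow_stay[of r 1 f] by simp

lemma src_Lw: "src Q Lw f r = (\<Sum>l\<le>degree Q. \<iota> (coeff Q l) * f (replicate l XP @ YM # r))"
  by (simp add: V_def poly_op_def XP_pow)

lemma src_Lr: "src Q (Lr n) f r = f (YP # replicate (Suc n) XM @ YM # r)"
proof -
  have "src Q (Lr n) f r = ins YP f (replicate (Suc n) XM @ YM # r)"
    using XM_pow_stay[of "YM # r" "Suc n" "ins YP f"] by (simp del: funpow.simps)
  then show ?thesis using src_Ly[of "replicate (Suc n) XM @ YM # r" Q f] by simp
qed

lemma tgt_Lr: "tgt Q (Lr n) f r = f (XM # replicate (Suc n) YM @ XP # r)"
proof -
  have "tgt Q (Lr n) f r = ins XM f (replicate (Suc n) YM @ XP # r)"
    by (simp add: YM_pow del: funpow.simps replicate.simps)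
  then show ?thesis by (simp add: ins_XM_stay)
qed

lemma tgt_Ly:
  assumes "r' = [] \<or> hd r' = XM"
  shows "tgt Q Ly f (replicate s YM @ r') = (\<Sum>l\<le>degree Q. \<iota> (coeff Q l) *
    f (XM # (if l \<le> s then replicate (s - l) YM else replicate (l - s) YP) @ r'))"
proof -
  have *: "(ins YP ^^ l) (ins XM f) (replicate s YM @ r') =
      f (XM # (if l \<le> s then replicate (s - l) YM else replicate (l - s) YP) @ r')" for l
  proof (cases "l \<le> s")
    case True
    then show ?thesis
      using assms by (cases "s - l") (auto simp: pop_YM ins_XM_stay)
  next
    case False
    then obtain k where "l - s = Suc k" by (cases "l - s") auto
    moreover from this have "\<not> l \<le> s" by simp
    moreover have "r' = [] \<or> hd r' \<notin> {XP, YM}" using assms by auto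
    ultimately show ?thesis
      by (simp add: pop_YM YP_pow_stay ins_XM_stay del: funpow.simps)
  qed
  show ?thesis by (simp add: H_def poly_op_def *)
qed

lemma src_local: "local_op src_reach (src Q)"
  unfolding local_op_def
proof (intro conjI allI impI ballI)
  show "[] \<in> src_reach []" by (simp add: src_reach_def)
next
  fix a u r and f g :: "sym list \<Rightarrow> 'a"
  assume t: "terminal (a # u)" and fg: "\<forall>r\<in>src_reach (a # u). f r = g r" and r: "r \<in> src_reach u"
  show "src Q a f r = src Q a g r"
  proof (cases a)
    case Lx
    show ?thesis
    proof (cases "r = [] \<or> hd r \<noteq> XP")
      case True
      then show ?thesis using fg Lx by (simp add: ins_XM_stay src_reach_def)
    next
      case False
      \<comment> \<open>A leading X excludes \<open>no_w u\<close>, hence also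
        \<open>no_w (Lx # u)\<close>, so \<open>src_reach (Lx # u)\<close> contains all
        words.\<close>
      then obtain r' where "r = XP # r'" by (cases r) auto
      with r fg Lx show ?thesis by (auto simp: src_reach_def)
    qed
  next
    case Ly
    then have "no_w u" using t by simp
    with r have "r = [] \<or> hd r \<notin> {XP, YM}" by (simp add: src_reach_def)
    then show ?thesis
      unfolding Ly src_Ly[OF \<open>r = [] \<or> hd r \<notin> {XP, YM}\<close>] using fg Ly by (simp add: src_reach_def)
  next
    case Lw
    then show ?thesis using fg unfolding Lw src_Lw by (simp add: src_reach_def)
  next
    case (Lr n)
    then show ?thesis using fg unfolding Lr src_Lr by (simp add: src_reach_def)
  qed
qed

lemma tgt_local: "local_op tgt_reach (tgt Q)"
  unfolding local_op_def
proof (intro conjI allI impI ballI)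
  show "[] \<in> tgt_reach []" by (simp add: tgt_reach_def)
next
  fix a u r and f g :: "sym list \<Rightarrow> 'a"
  assume t: "terminal (a # u)" and fg: "\<forall>r\<in>tgt_reach (a # u). f r = g r" and r: "r \<in> tgt_reach u"
  show "tgt Q a f r = tgt Q a g r"
  proof (cases a)
    case Lx
    have "YM # r \<in> tgt_reach (Lx # u)"
    proof -
      have "\<exists>s r'. YM # r = replicate s YM @ r' \<and> (r' = [] \<or> hd r' = XM)" if "no_w u"
      proof -
        from that r obtain s r' where "r = replicate s YM @ r'" "r' = [] \<or> hd r' = XM"
          by (auto simp: tgt_reach_def)
        then have "YM # r = replicate (Suc s) YM @ r' \<and> (r' = [] \<or> hd r' = XM)" by simp
        then show ?thesis by blast
      qed
      then show ?thesis by (simp add: tgt_reach_def)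
    qed
    then show ?thesis using fg Lx by simp
  next
    case Ly
    then have "no_w u" using t by simp
    with r obtain s r' where r': "r = replicate s YM @ r'" "r' = [] \<or> hd r' = XM"
      by (auto simp: tgt_reach_def)
    have "XM # z \<in> tgt_reach (a # u)" for z
    proof -
      have "XM # z = replicate 0 YM @ (XM # z) \<and> (XM # z = [] \<or> hd (XM # z) = XM)" by simp
      then show ?thesis unfolding tgt_reach_def by blast
    qed
    then show ?thesis unfolding Ly r'(1) tgt_Ly[OF r'(2)] using fg Ly by simp
  next
    case Lw
    then show ?thesis using fg by (simp add: tgt_reach_def)
  next
    case (Lr n)
    have "XM # z \<in> tgt_reach (a # u)" for z
    proof -
      have "XM # z = replicate 0 YM @ (XM # z) \<and> (XM # z = [] \<or> hd (XM # z) = XM)" by simp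
      then show ?thesis unfolding tgt_reach_def by blast
    qed
    then show ?thesis using fg unfolding Lr tgt_Lr by simp
  qed
qed

lemma ins_ev: "push a r \<noteq> None \<Longrightarrow> ins a ev r = sval a * ev r"
  by (auto simp: ins_def ev_push)

lemma ins_XM_ev: "ins XM ev r = inverse X * ev r"
  using ins_ev[of XM r] by (cases r) auto

lemma src_terminal: "terminal u \<Longrightarrow> word_op (src Q) u ev [] = prod_list (map (src_val Q) u)"
proof (rule word_op_terminal[OF src_local])
  fix a u r
  assume t: "terminal (a # u)" and r: "r \<in> src_reach u"
  show "src Q a ev r = src_val Q a * ev r"
  proof (cases a)
    case Ly
    then have "r = [] \<or> hd r \<notin> {XP, YM}" using t r by (simp add: src_reach_def)
    then show ?thesis unfolding Ly src_Ly[OF \<open>r = [] \<or> hd r \<notin> {XP, YM}\<close>] by simp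
  next
    case (Lr n)
    then show ?thesis unfolding Lr src_Lr by (simp add: ev_append ev_replicate mult.assoc)
  next
    case Lw
    then show ?thesis unfolding Lw src_Lw
      by (simp add: ev_append ev_replicate poly_at_def sum_distrib_right mult.assoc)
  qed (simp_all add: ins_XM_ev)
qed (rule nice_src)

lemma tgt_terminal: "terminal u \<Longrightarrow> word_op (tgt Q) u ev [] = prod_list (map (tgt_val Q) u)"
proof (rule word_op_terminal[OF tgt_local])
  fix a u r
  assume t: "terminal (a # u)" and r: "r \<in> tgt_reach u"
  show "tgt Q a ev r = tgt_val Q a * ev r"
  proof (cases a)
    case Ly
    then obtain s r' where r': "r = replicate s YM @ r'" "r' = [] \<or> hd r' = XM"
      using t r by (auto simp: tgt_reach_def)
    \<comment> \<open>The reduction of y^l Y^-s leaves Y^-(s-l) or Y^(l-s); in the skew field both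
      have the value Y^l Y^-s.\<close>
    have "ev ((if l \<le> s then replicate (s - l) YM else replicate (l - s) YP) @ r') = Y ^ l * ev r" for l
    proof -
      have "inverse Y ^ (s - l) = Y ^ l * inverse Y ^ s" if "l \<le> s"
      proof -
        have "inverse Y ^ s = inverse Y ^ l * inverse Y ^ (s - l)"
          using that by (simp flip: power_add)
        moreover have "Y ^ l * inverse Y ^ l = 1"
          using Y_nz by (simp add: power_inverse)
        ultimately show ?thesis by (simp flip: mult.assoc)
      qed
      moreover have "Y ^ (l - s) = Y ^ l * inverse Y ^ s" if "s \<le> l"
      proof -
        have "Y ^ l = Y ^ (l - s) * Y ^ s"
          using that by (simp flip: power_add)
        moreover have "Y ^ s * inverse Y ^ s = 1"
          using Y_nz by (simp add: power_inverse)
        ultimately show ?thesis by (simp add: mult.assoc)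
      qed
      ultimately show ?thesis by (auto simp: r'(1) ev_append ev_replicate mult.assoc)
    qed
    then show ?thesis unfolding Ly r'(1) tgt_Ly[OF r'(2)]
      by (simp add: poly_at_def \<iota>_left[of "inverse X"] sum_distrib_left sum_distrib_right r'(1) mult.assoc)
  next
    case (Lr n)
    then show ?thesis unfolding Lr tgt_Lr by (simp add: ev_append ev_replicate mult.assoc)
  qed simp_all
qed (rule nice_tgt)

section \<open>Homomorphisms over the scalars\<close>

definition fixing_hom :: "('a \<Rightarrow> 'a) \<Rightarrow> bool" where
  "fixing_hom G \<longleftrightarrow> (\<forall>a b. G (a + b) = G a + G b) \<and> (\<forall>a b. G (a * b) = G a * G b) \<and>
     (\<forall>c. G (\<iota> c) = \<iota> c)"

lemma
  assumes "fixing_hom G"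
  shows hom_add: "G (a + b) = G a + G b" and hom_mult: "G (a * b) = G a * G b"
    and hom_\<iota>: "G (\<iota> c) = \<iota> c" and hom_one: "G 1 = 1" and hom_zero: "G 0 = 0"
  using assms unfolding fixing_hom_def by (simp, simp, simp, metis \<iota>_one, metis \<iota>_zero)

lemma hom_sum: "fixing_hom G \<Longrightarrow> G (\<Sum>i\<in>I. f i) = (\<Sum>i\<in>I. G (f i))"
  by (induction I rule: infinite_finite_induct) (simp_all add: hom_zero hom_add)

lemma hom_power: "fixing_hom G \<Longrightarrow> G (a ^ n) = G a ^ n"
  by (induction n) (simp_all add: hom_one hom_mult)

lemma hom_inverse:
  assumes "fixing_hom G"
  shows "G (inverse a) = inverse (G a)"
proof (cases "a = 0")
  case False
  then have "G (inverse a) * G a = 1" using assms by (metis hom_mult hom_one left_inverse)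
  then show ?thesis by (metis inverse_unique inverse_inverse_eq)
qed (simp add: hom_zero[OF assms])

lemma hom_prod_list: "fixing_hom G \<Longrightarrow> G (prod_list as) = prod_list (map G as)"
  by (induction as) (simp_all add: hom_one hom_mult)

lemma hom_poly_at: "fixing_hom G \<Longrightarrow> G (poly_at \<iota> Q z) = poly_at \<iota> Q (G z)"
  by (simp add: poly_at_def hom_sum hom_mult hom_\<iota> hom_power)

text \<open>For W the polynomial cancels in Q(Y) (X^-1 Q(Y))^-1, leaving X. For \<open>Lr n\<close>
  it first commutes past the power of Y^-1 and then cancels.\<close>

lemma hom_src_val:
  assumes G: "fixing_hom G" and GX: "G X = Y" and GY: "G Y = inverse X * poly_at \<iota> Q Y"
    and nz: "poly_at \<iota> Q Y \<noteq> 0"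
  shows "G (src_val Q a) = tgt_val Q a"
proof (cases a)
  case Lx
  then show ?thesis by (simp add: hom_inverse[OF G] GX)
next
  case Lw
  have "G (src_val Q Lw) = poly_at \<iota> Q Y * inverse (inverse X * poly_at \<iota> Q Y)"
    by (simp add: hom_inverse[OF G] hom_mult[OF G] hom_poly_at[OF G] GX GY)
  also have "\<dots> = X"
    using nz X_nz by (simp add: nonzero_inverse_mult_distrib flip: mult.assoc)
  finally show ?thesis using Lw by simp
next
  case (Lr n)
  have c: "poly_at \<iota> Q Y * inverse Y ^ n = inverse Y ^ n * poly_at \<iota> Q Y" for n
  proof -
    have "inverse Y * Y ^ i = Y ^ i * inverse Y" for i
      using power_commuting_commutes[of Y "inverse Y" i] Y_nz by simp
    then have "inverse Y * poly_at \<iota> Q Y = poly_at \<iota> Q Y * inverse Y"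
      by (simp add: poly_at_def sum_distrib_left sum_distrib_right \<iota>_left[of "inverse Y"] mult.assoc)
    then show ?thesis using power_commuting_commutes[of "inverse Y" "poly_at \<iota> Q Y" n] by simp
  qed
  have "G (src_val Q (Lr n)) =
      inverse X * poly_at \<iota> Q Y * inverse Y ^ Suc n * inverse (inverse X * poly_at \<iota> Q Y)"
    by (simp add: hom_inverse[OF G] hom_mult[OF G] hom_power[OF G] GX GY del: power_Suc)
  also have "\<dots> = inverse X * (poly_at \<iota> Q Y * inverse Y ^ Suc n) * (inverse (poly_at \<iota> Q Y) * X)"
    using nz X_nz by (simp add: nonzero_inverse_mult_distrib mult.assoc del: power_Suc)
  also have "\<dots> = inverse X * inverse Y ^ Suc n * (poly_at \<iota> Q Y * inverse (poly_at \<iota> Q Y)) * X"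
    unfolding c by (simp only: mult.assoc)
  finally show ?thesis using Lr nz by simp
qed (simp add: GY)

text \<open>Induction on the number of letters W. The relation rewrites a factor y x^s W, on both
  sides with the same coefficients, into words with one W fewer. When no such factor is left, both
  values are products letter by letter.\<close>

lemma hom_word_op:
  assumes G: "fixing_hom G" and GX: "G X = Y" and GY: "G Y = inverse X * poly_at \<iota> Q Y"
    and nz: "poly_at \<iota> Q Y \<noteq> 0"
  shows "G (word_op (src Q) u ev []) = word_op (tgt Q) u ev []"
proof (induction "count_list u Lw" arbitrary: u rule: less_induct)
  case less
  show ?case
  proof (cases "terminal u")
    case True
    then show ?thesis
      by (simp add: src_terminal tgt_terminal hom_prod_list[OF G] hom_src_val[OF assms] o_def)
  next
    case False
    then obtain u1 s u2 where u: "u = u1 @ Ly # replicate s Lx @ Lw # u2" using not_terminal by blast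
    let ?v = "\<lambda>n. u1 @ r_word n @ u2"
    have split: "u = u1 @ (Ly # replicate s Lx @ [Lw]) @ u2" using u by simp
    have "count_list (replicate s Lx) Lw = 0" by (induction s) auto
    then have "count_list (?v n) Lw < count_list u Lw" for n
      using u by (simp add: r_word_def split: nat.split)
    then have IH: "G (word_op (src Q) (?v n) ev []) = word_op (tgt Q) (?v n) ev []" for n
      using less by blast
    have red: "word_op opr u ev [] = (\<Sum>l\<le>degree Q.
        (if l \<le> s then \<iota> (coeff Q l) else 0) * word_op opr (?v (s - l)) ev [])"
      if "\<And>f. word_op opr (Ly # replicate s Lx @ [Lw]) f = (\<lambda>r. \<Sum>l\<le>degree Q.
          (if l \<le> s then \<iota> (coeff Q l) else 0) * word_op opr (r_word (s - l)) f r)"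
        and "\<And>a. nice (opr a)" for opr
    proof -
      have "word_op opr u ev [] = word_op opr u2 (\<lambda>r. \<Sum>l\<le>degree Q.
          (if l \<le> s then \<iota> (coeff Q l) else 0) * word_op opr (r_word (s - l)) (word_op opr u1 ev) r) []"
        unfolding split word_op_append that(1) ..
      also have "\<dots> = (\<Sum>l\<le>degree Q. (if l \<le> s then \<iota> (coeff Q l) else 0) *
          word_op opr u2 (word_op opr (r_word (s - l)) (word_op opr u1 ev)) [])"
        by (rule nice_comb[OF nice_word_op[OF that(2)]]) simp
      finally show ?thesis by (simp add: word_op_append)
    qed
    have "G (if l \<le> s then \<iota> (coeff Q l) else 0) = (if l \<le> s then \<iota> (coeff Q l) else 0)" for l
      by (simp add: hom_\<iota>[OF G] hom_zero[OF G])
    then show ?thesis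
      by (simp only: red[of "src Q", OF src_reduce nice_src] red[of "tgt Q", OF tgt_reduce nice_tgt]
          hom_sum[OF G] hom_mult[OF G] IH)
  qed
qed

lemma cancel:
  "X * (inverse X * z) = z" "inverse X * (X * z) = z" "Y * (inverse Y * z) = z" "inverse Y * (Y * z) = z"
  using X_nz Y_nz by (simp_all flip: mult.assoc)

subsection \<open>Path sums\<close>

lemma nice_fold: "(\<And>x. nice (h x)) \<Longrightarrow> nice (fold h xs)"
proof (induction xs)
  case (Cons x xs)
  then show ?case using nice_comp[of "h x" "fold h xs"] by (simp add: o_def)
qed (simp add: nice_id id_def)

text \<open>In a path, \<open>True\<close> is a step \<open>h\<close> and \<open>False\<close> a step \<open>v\<close>.\<close>

definition edge :: "'k poly \<Rightarrow> 'k poly \<Rightarrow> bool \<Rightarrow> (sym list \<Rightarrow> 'a) \<Rightarrow> sym list \<Rightarrow> 'a" where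
  "edge A B b = (if b then H A else V B)"

definition path_sum :: "'k poly \<Rightarrow> 'k poly \<Rightarrow> bool list \<Rightarrow> 'a" where
  "path_sum A B w = fold (edge A B) w ev []"

text \<open>The block h v^c = x P(y) W^c without its leading x.\<close>

definition src_block :: "'k poly \<Rightarrow> 'k poly \<Rightarrow> nat \<Rightarrow> (sym list \<Rightarrow> 'a) \<Rightarrow> sym list \<Rightarrow> 'a" where
  "src_block P Q c f = (V Q ^^ c) (poly_op P YP f)"

text \<open>This is P(H) X^c Y^-1, the image of P(y) W^c x; the final Y^-1 comes from the x that
  follows the block.\<close>

definition tgt_block :: "'k poly \<Rightarrow> 'k poly \<Rightarrow> nat \<Rightarrow> (sym list \<Rightarrow> 'a) \<Rightarrow> sym list \<Rightarrow> 'a" where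
  "tgt_block P Q c f =
     ins YM ((ins XP ^^ c) (\<lambda>r. \<Sum>i\<le>degree P. \<iota> (coeff P i) * (H Q ^^ i) f r))"

lemma nice_src_block: "nice (src_block P Q c)"
  unfolding src_block_def[abs_def] by (rule nice_comp[OF nice_poly_op nice_funpow[OF nice_V]])

lemma nice_tgt_block: "nice (tgt_block P Q c)"
  unfolding tgt_block_def[abs_def]
  by (rule nice_comp[OF nice_comp[OF nice_scaled_sum nice_funpow[OF nice_ins]] nice_ins])
     (rule nice_funpow[OF nice_H])

lemma src_block_word:
  "ins XM (src_block P Q c (word_op (src Q) u ev)) = (\<lambda>r. \<Sum>i\<le>degree P. \<iota> (coeff P i) *
     word_op (src Q) (u @ replicate i Ly @ replicate c Lw @ [Lx]) ev r)"
proof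
  fix r
  have n: "nice (\<lambda>f. ins XM ((V Q ^^ c) f))"
    by (rule nice_comp[OF nice_funpow[OF nice_V] nice_ins])
  show "ins XM (src_block P Q c (word_op (src Q) u ev)) r = (\<Sum>i\<le>degree P. \<iota> (coeff P i) *
     word_op (src Q) (u @ replicate i Ly @ replicate c Lw @ [Lx]) ev r)"
    using nice_comb[OF n, of "{..degree P}" "\<lambda>i. \<iota> (coeff P i)" "\<lambda>i. (ins YP ^^ i) (word_op (src Q) u ev)"]
    by (simp add: src_block_def poly_op_def[abs_def] word_op_append word_op_replicate)
qed

lemma tgt_block_word:
  "tgt_block P Q c (word_op (tgt Q) u ev) = (\<lambda>r. \<Sum>i\<le>degree P. \<iota> (coeff P i) *
     word_op (tgt Q) (u @ replicate i Ly @ replicate c Lw @ [Lx]) ev r)"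
proof
  fix r
  have n: "nice (\<lambda>f. ins YM ((ins XP ^^ c) f))"
    by (rule nice_comp[OF nice_funpow[OF nice_ins] nice_ins])
  show "tgt_block P Q c (word_op (tgt Q) u ev) r = (\<Sum>i\<le>degree P. \<iota> (coeff P i) *
     word_op (tgt Q) (u @ replicate i Ly @ replicate c Lw @ [Lx]) ev r)"
    using nice_comb[OF n, of "{..degree P}" "\<lambda>i. \<iota> (coeff P i)" "\<lambda>i. (H Q ^^ i) (word_op (tgt Q) u ev)"]
    by (simp only: tgt_block_def word_op_append word_op_replicate word_op.simps tgt.simps finite_atMost)
qed

text \<open>Only P(y) is expanded, block by block. The prefix \<open>u\<close> is arbitrary, so that
  the letters chosen in one block join the prefix for the next.\<close>

lemma hom_blocks:
  assumes G: "fixing_hom G" and GX: "G X = Y" and GY: "G Y = inverse X * poly_at \<iota> Q Y"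
    and nz: "poly_at \<iota> Q Y \<noteq> 0"
  shows "G (fold (\<lambda>c f. ins XM (src_block P Q c f)) cs (word_op (src Q) u ev) [])
    = fold (tgt_block P Q) cs (word_op (tgt Q) u ev) []"
proof (induction cs arbitrary: u)
  case Nil
  then show ?case using hom_word_op[OF assms] by simp
next
  case (Cons c cs)
  have n: "nice (fold (\<lambda>c f. ins XM (src_block P Q c f)) cs)"
    by (rule nice_fold, rule nice_comp[OF nice_src_block nice_ins])
  have n': "nice (fold (tgt_block P Q) cs)"
    by (rule nice_fold, rule nice_tgt_block)
  show ?case
    by (simp add: nice_comb[OF n] nice_comb[OF n'] src_block_word tgt_block_word hom_sum[OF G] hom_mult[OF G] hom_\<iota>[OF G] Cons.IH)
qed

text \<open>Since no rule has \<open>x\<close> as its second letter, and prepending \<open>x\<close> never gives \<open>0\<close>, conjugation by \<open>X\<close>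
  moves the leading \<open>x\<close> of a product of blocks to its end.\<close>

lemma fold_rotate: "fold (\<lambda>c f. A (B c f)) cs (A f) = A (fold (\<lambda>c f. B c (A f)) cs f)"
  by (induction cs arbitrary: f) simp_all

section \<open>Paths as sequences of blocks\<close>

definition blocks :: "nat list \<Rightarrow> bool list" where
  "blocks cs = concat (map (\<lambda>c. True # replicate c False) cs)"

definition mutate_path :: "nat \<Rightarrow> nat list \<Rightarrow> bool list" where
  "mutate_path d cs = concat (map (\<lambda>c. replicate (d - c) True @ [False]) cs)"

lemma fold_replicate: "fold h (replicate n x) f = (h x ^^ n) f"
  by (induction n arbitrary: f) (auto simp: funpow_swap1)

lemma fold_concat_map: "fold h (concat (map e cs)) f = fold (\<lambda>c. fold h (e c)) cs f"
  by (induction cs arbitrary: f) simp_all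

lemma path_sum_blocks:
  "path_sum P Q (blocks cs) = fold (\<lambda>c f. src_block P Q c (ins XM f)) cs ev []"
  by (simp add: path_sum_def blocks_def fold_concat_map fold_replicate edge_def src_block_def H_def[abs_def] o_def)

lemma conj_path_sum_blocks:
  "X * path_sum P Q (blocks cs) * inverse X = fold (\<lambda>c f. ins XM (src_block P Q c f)) cs ev []"
proof -
  have n: "nice (fold (\<lambda>c f. ins XM (src_block P Q c f)) cs)"
    and n': "nice (fold (\<lambda>c f. src_block P Q c (ins XM f)) cs)"
    by (rule nice_fold, rule nice_comp[OF nice_src_block nice_ins],
        rule nice_fold, rule nice_comp[OF nice_ins nice_src_block])
  have "inverse X * fold (\<lambda>c f. ins XM (src_block P Q c f)) cs ev []
      = fold (\<lambda>c f. ins XM (src_block P Q c f)) cs (ins XM ev) []"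
    using nice_left[OF n, of "inverse X" ev "[]"] by (simp add: ins_XM_ev[abs_def])
  \<comment> \<open>After \<open>fold_rotate\<close> the extra x stands at the right end, where it
    acts on the empty word and produces the trailing \<open>XM\<close>.\<close>
  also have "\<dots> = fold (\<lambda>c f. src_block P Q c (ins XM f)) cs ev ([] @ [XM])"
    by (simp add: fold_rotate ins_XM_stay)
  also have "\<dots> = path_sum P Q (blocks cs) * inverse X"
    unfolding nice_snoc[OF n'] using nice_right[OF n', of ev "inverse X" "[]"]
    by (simp add: path_sum_blocks ev_append)
  finally have e: "path_sum P Q (blocks cs) * inverse X =
      inverse X * fold (\<lambda>c f. ins XM (src_block P Q c f)) cs ev []" ..
  show ?thesis unfolding mult.assoc e by (simp add: cancel)
qed

text \<open>The operator form of H X = 1: positive powers of y vanish in front of X, and x q_0 X = 1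
  remains.\<close>

lemma XP_H:
  assumes "coeff Q 0 = 1"
  shows "ins XP (H Q f) = f"
proof
  fix r
  have "(\<Sum>l\<le>degree Q. \<iota> (coeff Q l) * (ins YP ^^ l) (ins XM f) (XP # r))
      = (\<Sum>l\<in>{0}. \<iota> (coeff Q l) * (ins YP ^^ l) (ins XM f) (XP # r))"
    by (rule sum.mono_neutral_right) (auto simp: YP_kill)
  then show "ins XP (H Q f) r = f r" by (simp add: H_def poly_op_def assms \<iota>_one)
qed

lemma XP_H_cancel:
  assumes "coeff Q 0 = 1"
  shows "(ins XP ^^ (n + k)) ((H Q ^^ (m + k)) f) = (ins XP ^^ n) ((H Q ^^ m) f)"
proof (induction k)
  case (Suc k)
  have "(ins XP ^^ (n + Suc k)) ((H Q ^^ (m + Suc k)) f)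
      = (ins XP ^^ (n + k)) (ins XP (H Q ((H Q ^^ (m + k)) f)))"
    by (simp add: funpow_swap1)
  then show ?case by (simp only: XP_H[OF assms] Suc)
qed simp

text \<open>Cancelling pairs H X turns both sides into H^(i-c) if c <= i, and into X^(c-i)
  otherwise.\<close>

lemma XP_H_balance:
  assumes "coeff Q 0 = 1" "i \<le> d" "c \<le> d"
  shows "(ins XP ^^ c) ((H Q ^^ i) f) = (ins XP ^^ (d - i)) ((H Q ^^ (d - c)) f)"
proof (cases "c \<le> i")
  case True
  then have e: "d - c = (i - c) + (d - i)" "i = (i - c) + c" using assms by auto
  have "(ins XP ^^ c) ((H Q ^^ i) f) = (H Q ^^ (i - c)) f"
    using XP_H_cancel[OF assms(1), of 0 c "i - c" f] e(2) by simp
  moreover have "(ins XP ^^ (d - i)) ((H Q ^^ (d - c)) f) = (H Q ^^ (i - c)) f"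
    using XP_H_cancel[OF assms(1), of 0 "d - i" "i - c" f] e(1) by simp
  ultimately show ?thesis by simp
next
  case False
  then have e: "d - i = (c - i) + (d - c)" "c = (c - i) + i" using assms by auto
  have "(ins XP ^^ c) ((H Q ^^ i) f) = (ins XP ^^ (c - i)) f"
    using XP_H_cancel[OF assms(1), of "c - i" i 0 f] e(2) by simp
  moreover have "(ins XP ^^ (d - i)) ((H Q ^^ (d - c)) f) = (ins XP ^^ (c - i)) f"
    using XP_H_cancel[OF assms(1), of "c - i" "d - c" 0 f] e(1) by simp
  ultimately show ?thesis by simp
qed

text \<open>Balancing each H^i X^c gives the common left factor H^(d-c), independent of i. The
  remaining powers X^(d-i) assemble to the reflected polynomial at X.\<close>

lemma tgt_block_edges:
  assumes Q: "coeff Q 0 = 1" and P: "coeff P 0 \<noteq> 0" and c: "c \<le> degree P"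
  shows "tgt_block P Q c f = V (reflect_poly P) ((H Q ^^ (degree P - c)) f)"
proof -
  let ?g = "(H Q ^^ (degree P - c)) f"
  have "(ins XP ^^ c) (\<lambda>r. \<Sum>i\<le>degree P. \<iota> (coeff P i) * (H Q ^^ i) f r)
      = poly_op (reflect_poly P) XP ?g"
  proof
    fix r
    have "(ins XP ^^ c) (\<lambda>r. \<Sum>i\<le>degree P. \<iota> (coeff P i) * (H Q ^^ i) f r) r
        = (\<Sum>i\<le>degree P. \<iota> (coeff P i) * (ins XP ^^ c) ((H Q ^^ i) f) r)"
      by (rule nice_comb[OF nice_funpow[OF nice_ins]]) simp
    also have "\<dots> = (\<Sum>i\<le>degree P. \<iota> (coeff P i) * (ins XP ^^ (degree P - i)) ?g r)"
      using XP_H_balance[OF Q _ c] by (intro sum.cong) simp_all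
    also have "\<dots> = (\<Sum>i\<le>degree P. \<iota> (coeff P (degree P - i)) * (ins XP ^^ i) ?g r)"
      by (rule sum.reindex_bij_witness[where i="\<lambda>i. degree P - i" and j="\<lambda>i. degree P - i"]) auto
    also have "\<dots> = poly_op (reflect_poly P) XP ?g r"
      using P by (simp add: poly_op_def coeff_reflect_poly)
    finally show "(ins XP ^^ c) (\<lambda>r. \<Sum>i\<le>degree P. \<iota> (coeff P i) * (H Q ^^ i) f r) r
        = poly_op (reflect_poly P) XP ?g r" .
  qed
  then show ?thesis by (simp add: tgt_block_def V_def)
qed

lemma fixing_hom_conj:
  assumes "fixing_hom \<phi>"
  shows "fixing_hom (\<lambda>z. inverse X * \<phi> z * X)"
  unfolding fixing_hom_def
proof (intro conjI allI)
  fix a b c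
  show "inverse X * \<phi> (a + b) * X = inverse X * \<phi> a * X + inverse X * \<phi> b * X"
    by (simp add: hom_add[OF assms] distrib_left distrib_right)
  show "inverse X * \<phi> (a * b) * X = inverse X * \<phi> a * X * (inverse X * \<phi> b * X)"
    by (simp add: hom_mult[OF assms] mult.assoc cancel)
  show "inverse X * \<phi> (\<iota> c) * X = \<iota> c"
    by (simp add: hom_\<iota>[OF assms] mult.assoc \<iota>_central[of c X] cancel)
qed

text \<open>Conjugating \<open>\<phi>\<close> by X gives a homomorphism with X to Y and Y to X^-1
  Q(Y), so \<open>hom_blocks\<close> applies; the conjugation of the path sum by X supplies the form
  P(y) W^c x of the blocks.\<close>

lemma mutate_path_sum:
  assumes \<phi>: "fixing_hom \<phi>" and \<phi>X: "\<phi> X = X * Y * inverse X" and \<phi>Y: "\<phi> Y = poly_at \<iota> Q Y * inverse X"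
    and nz: "poly_at \<iota> Q Y \<noteq> 0" and Q: "coeff Q 0 = 1" and P: "coeff P 0 \<noteq> 0"
    and cs: "\<forall>c\<in>set cs. c \<le> degree P"
  shows "\<phi> (X * path_sum P Q (blocks cs) * inverse X) =
    X * path_sum Q (reflect_poly P) (mutate_path (degree P) cs) * inverse X"
proof -
  let ?G = "\<lambda>z. inverse X * \<phi> z * X"
  have "fold (tgt_block P Q) cs f = fold (edge Q (reflect_poly P)) (mutate_path (degree P) cs) f" for f
    using cs by (induction cs arbitrary: f)
      (simp_all add: tgt_block_edges[OF Q P] mutate_path_def fold_replicate edge_def)
  then have "fold (tgt_block P Q) cs ev [] = path_sum Q (reflect_poly P) (mutate_path (degree P) cs)"
    by (simp add: path_sum_def)
  moreover have "?G (fold (\<lambda>c f. ins XM (src_block P Q c f)) cs ev []) = fold (tgt_block P Q) cs ev []"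
    using hom_blocks[OF fixing_hom_conj[OF \<phi>] _ _ nz, of P cs "[]"] X_nz
    by (simp add: \<phi>X \<phi>Y mult.assoc cancel)
  ultimately have e: "path_sum Q (reflect_poly P) (mutate_path (degree P) cs)
      = inverse X * \<phi> (X * path_sum P Q (blocks cs) * inverse X) * X"
    by (simp add: conj_path_sum_blocks)
  show ?thesis unfolding e by (simp add: mult.assoc cancel X_nz)
qed

lemma path_sum_h: "path_sum A B [True] = inverse X * poly_at \<iota> A Y"
  using tgt_terminal[of "[Ly]" A] by (simp add: path_sum_def edge_def)

lemma path_sum_v: "path_sum A B [False] = poly_at \<iota> B X * inverse Y"
  using src_terminal[of "[Lw]" B] by (simp add: path_sum_def edge_def)

subsection \<open>Pseudo-positive Laurent polynomials\<close>

definition laurent :: "'k set \<Rightarrow> 'a set" where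
  "laurent A = laurent_semiring \<iota> A X Y"

definition semiring_set :: "'k set \<Rightarrow> bool" where
  "semiring_set A \<longleftrightarrow> 0 \<in> A \<and> 1 \<in> A \<and> (\<forall>a\<in>A. \<forall>b\<in>A. a + b \<in> A \<and> a * b \<in> A)"

lemma laurent_zero: "0 \<in> laurent A"
  unfolding laurent_def laurent_semiring_def by (rule CollectI, rule exI[of _ "[]"]) simp

lemma laurent_add:
  assumes "x \<in> laurent A" "y \<in> laurent A"
  shows "x + y \<in> laurent A"
proof -
  obtain ts us where "x = (\<Sum>(a, w)\<leftarrow>ts. \<iota> a * w)" "set ts \<subseteq> A \<times> laurent_words X Y"
    "y = (\<Sum>(a, w)\<leftarrow>us. \<iota> a * w)" "set us \<subseteq> A \<times> laurent_words X Y"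
    using assms unfolding laurent_def laurent_semiring_def by blast
  then have "x + y = (\<Sum>(a, w)\<leftarrow>ts @ us. \<iota> a * w)" "set (ts @ us) \<subseteq> A \<times> laurent_words X Y"
    by auto
  then show ?thesis unfolding laurent_def laurent_semiring_def by blast
qed

lemma laurent_sum: "(\<And>i. i \<in> I \<Longrightarrow> f i \<in> laurent A) \<Longrightarrow> (\<Sum>i\<in>I. f i) \<in> laurent A"
  by (induction I rule: infinite_finite_induct) (simp_all add: laurent_zero laurent_add)

text \<open>Additivity reduces closure to single monomials. It is used for scaling, for
  multiplication by words and for homomorphisms.\<close>

lemma laurent_map:
  assumes x: "x \<in> laurent A"
    and h: "\<And>a w. a \<in> A \<Longrightarrow> w \<in> laurent_words X Y \<Longrightarrow> h (\<iota> a * w) \<in> laurent A"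
    and add: "\<And>x y. h (x + y) = h x + h y"
  shows "h x \<in> laurent A"
proof -
  have z: "h 0 = 0" using add[of 0 0] by simp
  have "h (\<Sum>(a, w)\<leftarrow>ts. \<iota> a * w) \<in> laurent A" if "set ts \<subseteq> A \<times> laurent_words X Y" for ts
    using that by (induction ts) (auto simp: z add laurent_zero intro!: laurent_add h)
  then show ?thesis using x unfolding laurent_def laurent_semiring_def by blast
qed

lemma laurent_monomial:
  assumes "a \<in> A" "w \<in> laurent_words X Y"
  shows "\<iota> a * w \<in> laurent A"
  using assms unfolding laurent_def laurent_semiring_def by (intro CollectI exI[of _ "[(a, w)]"]) simp

lemma laurent_scale: "semiring_set A \<Longrightarrow> a \<in> A \<Longrightarrow> x \<in> laurent A \<Longrightarrow> \<iota> a * x \<in> laurent A"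
  by (rule laurent_map)
     (auto simp: distrib_left semiring_set_def simp flip: mult.assoc \<iota>_mult intro: laurent_monomial)

lemma laurent_words_mult:
  "w \<in> laurent_words X Y \<Longrightarrow> w' \<in> laurent_words X Y \<Longrightarrow> w * w' \<in> laurent_words X Y"
  unfolding laurent_words_def
proof clarify
  fix ws ws'
  assume "set ws \<subseteq> {X, inverse X, Y, inverse Y}" "set ws' \<subseteq> {X, inverse X, Y, inverse Y}"
  then show "\<exists>vs. prod_list ws * prod_list ws' = prod_list vs \<and> set vs \<subseteq> {X, inverse X, Y, inverse Y}"
    by (intro exI[of _ "ws @ ws'"]) auto
qed

lemma laurent_words_ev: "ev r \<in> laurent_words X Y"
proof -
  have "ev r = prod_list (map sval r)" by (induction r) auto
  moreover have "sval a \<in> {X, inverse X, Y, inverse Y}" for a by (cases a) auto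
  ultimately show ?thesis unfolding laurent_words_def by fastforce
qed

lemma laurent_ev_mult: "x \<in> laurent A \<Longrightarrow> ev r * x \<in> laurent A"
  by (rule laurent_map)
     (auto simp: distrib_left \<iota>_left[of "ev r"] intro!: laurent_monomial laurent_words_mult laurent_words_ev)

lemma laurent_mult_ev: "x \<in> laurent A \<Longrightarrow> x * ev r \<in> laurent A"
  by (rule laurent_map)
     (auto simp: distrib_right mult.assoc intro!: laurent_monomial laurent_words_mult laurent_words_ev)

lemma laurent_ev: "semiring_set A \<Longrightarrow> ev r \<in> laurent A"
  using laurent_monomial[of 1 A "ev r"] by (simp add: semiring_set_def \<iota>_one laurent_words_ev)

lemma laurent_ins_pow: "(\<And>r. f r \<in> laurent A) \<Longrightarrow> (ins a ^^ n) f r \<in> laurent A"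
proof (induction n arbitrary: r)
  case (Suc n)
  then show ?case by (auto simp: ins_def[of a] laurent_zero split: option.split)
qed simp

lemma laurent_poly_op:
  assumes "semiring_set A" "\<forall>i. coeff P i \<in> A" "\<And>r. f r \<in> laurent A"
  shows "poly_op P a f r \<in> laurent A"
  unfolding poly_op_def using assms by (intro laurent_sum laurent_scale laurent_ins_pow) auto

lemma laurent_edge:
  assumes "semiring_set S" "\<forall>i. coeff A i \<in> S" "\<forall>i. coeff B i \<in> S" "\<And>r. f r \<in> laurent S"
  shows "edge A B b f r \<in> laurent S"
proof -
  have *: "ins XM f r \<in> laurent S" for r
    using laurent_ins_pow[of f S 1 XM] assms(4) by simp
  show ?thesis
    using laurent_poly_op[OF assms(1,2) *] laurent_poly_op[OF assms(1,3,4)]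
    by (cases b) (simp_all add: edge_def H_def V_def)
qed

text \<open>A reduction returns a word or 0, and all coefficients lie in \<open>S\<close>; no step
  subtracts. The invariant concerns the values at all words, since the operators evaluate their
  argument at other words.\<close>

lemma laurent_path_sum:
  assumes "semiring_set S" "\<forall>i. coeff A i \<in> S" "\<forall>i. coeff B i \<in> S"
  shows "path_sum A B w \<in> laurent S"
proof -
  have "fold (edge A B) w f r \<in> laurent S" if "\<And>r. f r \<in> laurent S" for f r
    using that by (induction w arbitrary: f r) (simp_all add: laurent_edge[OF assms])
  then show ?thesis unfolding path_sum_def using laurent_ev[OF assms(1)] by blast
qed

end

subsection \<open>The automorphisms\<close>

lemma ring_hom_type_ring:
  "\<phi> \<in> ring_hom (type_ring :: 'r::ring_1 ring) (type_ring :: 's::ring_1 ring) \<longleftrightarrow>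
    (\<forall>x y. \<phi> (x + y) = \<phi> x + \<phi> y) \<and> (\<forall>x y. \<phi> (x * y) = \<phi> x * \<phi> y) \<and> \<phi> 1 = 1"
  by (auto simp: ring_hom_def type_ring_def)

lemma ring_type_ring: "ring (type_ring :: 'r::ring_1 ring)"
  by unfold_locales
    (auto simp: type_ring_def Units_def algebra_simps intro: exI[of _ "- x" for x] add.right_inverse)

lemma skew_field_type_ring: "skew_field (type_ring :: 'r::division_ring ring)"
proof -
  have "Units (type_ring :: 'r ring) = UNIV - {0}"
  proof
    show "Units (type_ring :: 'r ring) \<subseteq> UNIV - {0}"
      by (auto simp: Units_def type_ring_def)
    show "UNIV - {0} \<subseteq> Units (type_ring :: 'r ring)"
    proof
      fix x :: 'r
      assume "x \<in> UNIV - {0}"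
      then have "inverse x * x = 1" "x * inverse x = 1" by auto
      then show "x \<in> Units (type_ring :: 'r ring)" by (auto simp: Units_def type_ring_def)
    qed
  qed
  then show ?thesis unfolding skew_field_def using ring_type_ring by (simp add: type_ring_def)
qed

text \<open>A specialization of the skew field to itself over the scalars: the domain is a subring
  in which every element with nonzero image is invertible.\<close>

definition partial_hom :: "('k \<Rightarrow> 'a::division_ring) \<Rightarrow> 'a set \<Rightarrow> ('a \<Rightarrow> 'a) \<Rightarrow> bool" where
  "partial_hom \<iota> L f \<longleftrightarrow> (\<forall>c. \<iota> c \<in> L \<and> f (\<iota> c) = \<iota> c) \<and> 1 \<in> L \<and> f 1 = 1 \<and>
     (\<forall>x\<in>L. \<forall>y\<in>L. x - y \<in> L \<and> f (x - y) = f x - f y) \<and>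
     (\<forall>x\<in>L. \<forall>y\<in>L. x * y \<in> L \<and> f (x * y) = f x * f y) \<and>
     (\<forall>x\<in>L. f x \<noteq> 0 \<longrightarrow> inverse x \<in> L \<and> f (inverse x) = inverse (f x))"

lemma
  assumes "partial_hom \<iota> L f"
  shows partial_hom_\<iota>: "\<iota> c \<in> L" "f (\<iota> c) = \<iota> c"
    and partial_hom_one: "1 \<in> L" "f 1 = 1"
    and partial_hom_diff: "x \<in> L \<Longrightarrow> y \<in> L \<Longrightarrow> x - y \<in> L" "x \<in> L \<Longrightarrow> y \<in> L \<Longrightarrow> f (x - y) = f x - f y"
    and partial_hom_mult: "x \<in> L \<Longrightarrow> y \<in> L \<Longrightarrow> x * y \<in> L" "x \<in> L \<Longrightarrow> y \<in> L \<Longrightarrow> f (x * y) = f x * f y"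
    and partial_hom_inverse: "x \<in> L \<Longrightarrow> f x \<noteq> 0 \<Longrightarrow> inverse x \<in> L"
      "x \<in> L \<Longrightarrow> f x \<noteq> 0 \<Longrightarrow> f (inverse x) = inverse (f x)"
  using assms unfolding partial_hom_def by auto

lemma partial_hom_zero:
  assumes "partial_hom \<iota> L f"
  shows "0 \<in> L" "f 0 = 0"
  using partial_hom_diff[OF assms partial_hom_one(1)[OF assms] partial_hom_one(1)[OF assms]] by auto

lemma partial_hom_add:
  assumes "partial_hom \<iota> L f" "x \<in> L" "y \<in> L"
  shows "x + y \<in> L" "f (x + y) = f x + f y"
proof -
  have "0 - y \<in> L" "f (0 - y) = - f y"
    using partial_hom_diff[OF assms(1) partial_hom_zero(1)[OF assms(1)] assms(3)]
      partial_hom_zero(2)[OF assms(1)] by auto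
  then show "x + y \<in> L" "f (x + y) = f x + f y"
    using partial_hom_diff[OF assms(1,2) \<open>0 - y \<in> L\<close>] by simp_all
qed

lemma partial_hom_poly_at:
  assumes f: "partial_hom \<iota> L f" and y: "y \<in> L"
  shows "poly_at \<iota> P y \<in> L" "f (poly_at \<iota> P y) = poly_at \<iota> P (f y)"
proof -
  have p: "y ^ i \<in> L \<and> f (y ^ i) = f y ^ i" for i
    by (induction i) (simp_all add: partial_hom_one[OF f] partial_hom_mult[OF f y])
  have "(\<Sum>i\<in>I. \<iota> (coeff P i) * y ^ i) \<in> L \<and>
      f (\<Sum>i\<in>I. \<iota> (coeff P i) * y ^ i) = (\<Sum>i\<in>I. \<iota> (coeff P i) * f y ^ i)" for I
    by (induction I rule: infinite_finite_induct)
      (simp_all add: partial_hom_zero[OF f] partial_hom_add[OF f] partial_hom_mult[OF f]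
        partial_hom_\<iota>[OF f] p)
  then show "poly_at \<iota> P y \<in> L" "f (poly_at \<iota> P y) = poly_at \<iota> P (f y)"
    by (simp_all add: poly_at_def)
qed

text \<open>The composite is defined on the preimage of \<open>M\<close>. It contains the required
  inverses because a nonzero value of g(f(x)) forces f(x) to be nonzero.\<close>

lemma partial_hom_comp:
  assumes f: "partial_hom \<iota> L f" and g: "partial_hom \<iota> M g"
  shows "partial_hom \<iota> {x \<in> L. f x \<in> M} (g \<circ> f)"
proof -
  have "f x \<noteq> 0" if "g (f x) \<noteq> 0" for x
    using that partial_hom_zero[OF g] by auto
  then show ?thesis
    unfolding partial_hom_def[of \<iota> "{x \<in> L. f x \<in> M}"]
    using partial_hom_\<iota>[OF f] partial_hom_\<iota>[OF g] partial_hom_one[OF f] partial_hom_one[OF g]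
      partial_hom_diff[OF f] partial_hom_diff[OF g] partial_hom_mult[OF f] partial_hom_mult[OF g]
      partial_hom_inverse[OF f] partial_hom_inverse[OF g] by simp
qed

lemma partial_hom_eq_id:
  assumes f: "partial_hom \<iota> L f" and gen: "generates_skew_field \<iota> X Y"
    and "X \<in> L" "f X = X" "Y \<in> L" "f Y = Y"
  shows "L = UNIV" "f x = x"
proof -
  let ?S = "{x \<in> L. f x = x}"
  \<comment> \<open>For x = 0 this uses the convention \<open>inverse 0 = 0\<close>; for other fixed
    points the image x is nonzero.\<close>
  have "inverse x \<in> ?S" if "x \<in> ?S" for x
    using that partial_hom_inverse[OF f, of x] partial_hom_zero[OF f] by (cases "x = 0") auto
  then have "?S = UNIV"
    using gen[unfolded generates_skew_field_def, rule_format, of ?S] assms(3-) partial_hom_\<iota>[OF f]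
      partial_hom_diff[OF f] partial_hom_mult[OF f] by auto
  then show "L = UNIV" "f x = x" by auto
qed

text \<open>The universal property is applied with the skew field itself as target
  \<open>D\<close>.\<close>

lemma free_skew_field_specialize:
  fixes \<iota> :: "'k::field \<Rightarrow> 'a::division_ring"
  assumes "free_skew_field \<iota> X Y"
  obtains L f where "partial_hom \<iota> L f" "X \<in> L" "Y \<in> L" "f X = a" "f Y = b"
proof -
  have "has_specialization \<iota> X Y type_ring \<iota> a b"
  proof -
    have "a \<in> carrier type_ring" "b \<in> carrier type_ring" by (simp_all add: type_ring_def)
    then show ?thesis using assms skew_field_type_ring unfolding free_skew_field_def by blast
  qed
  then obtain L f where r: "ring (type_ring\<lparr>carrier := L\<rparr>)" and L: "range \<iota> \<subseteq> L" "X \<in> L" "Y \<in> L"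
    and f: "f \<in> ring_hom (type_ring\<lparr>carrier := L\<rparr>) type_ring"
    and fv: "\<And>c. f (\<iota> c) = \<iota> c" "f X = a" "f Y = b"
    and inv: "\<And>x. x \<in> L \<Longrightarrow> f x \<noteq> 0 \<Longrightarrow> inverse x \<in> L"
    unfolding has_specialization_def by (auto simp: type_ring_def)
  interpret R: ring "type_ring\<lparr>carrier := L\<rparr>" by (rule r)
  have add: "x + y \<in> L \<and> f (x + y) = f x + f y" if "x \<in> L" "y \<in> L" for x y
    using R.add.m_closed[of x y] ring_hom_add[OF f, of x y] that by (simp add: type_ring_def)
  have mult: "x * y \<in> L \<and> f (x * y) = f x * f y" if "x \<in> L" "y \<in> L" for x y
    using R.m_closed[of x y] ring_hom_mult[OF f, of x y] that by (simp add: type_ring_def)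
  have one: "1 \<in> L" "f 1 = 1"
    using R.one_closed ring_hom_one[OF f] by (simp_all add: type_ring_def)
  have zero: "0 \<in> L" using R.zero_closed by (simp add: type_ring_def)
  have f0: "f 0 = 0" using add[OF zero zero] by simp
  have neg: "- x \<in> L \<and> f (- x) = - f x" if x: "x \<in> L" for x
  proof -
    obtain y where "y \<in> L" "y + x = 0"
      using R.add.l_inv_ex[of x] x by (auto simp: type_ring_def)
    then have "- x \<in> L" by (metis eq_neg_iff_add_eq_0)
    moreover have "f (- x) + f x = 0" using add[OF \<open>- x \<in> L\<close> that] f0 by simp
    ultimately show ?thesis by (metis eq_neg_iff_add_eq_0)
  qed
  have diff: "x - y \<in> L \<and> f (x - y) = f x - f y" if "x \<in> L" "y \<in> L" for x y
    using add[of x "- y"] neg[of y] that by simp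
  have inv': "f (inverse x) = inverse (f x)" if "x \<in> L" "f x \<noteq> 0" for x
  proof -
    have "x \<noteq> 0" using that f0 by auto
    then have "f x * f (inverse x) = 1" using mult[OF that(1) inv[OF that]] one(2) by simp
    then show ?thesis by (metis inverse_unique)
  qed
  have "\<iota> c \<in> L" for c using L(1) by auto
  then have "partial_hom \<iota> L f"
    by (simp add: partial_hom_def fv(1) one diff mult inv inv')
  then show ?thesis using that L fv by blast
qed

locale free_generators =
  fixes \<iota> :: "'k::field_char_0 \<Rightarrow> 'a::division_ring" and X Y :: 'a
  assumes free: "free_skew_field \<iota> X Y"
begin

lemma generates: "generates_skew_field \<iota> X Y"
  using free by (simp add: free_skew_field_def)

sublocale two_generators \<iota> X Y
proof
  have "algebra_map \<iota> type_ring" using free by (simp add: free_skew_field_def)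
  then have h: "\<iota> \<in> ring_hom type_ring type_ring"
    and c: "\<forall>c. \<forall>x\<in>carrier type_ring. \<iota> c \<otimes>\<^bsub>type_ring\<^esub> x = x \<otimes>\<^bsub>type_ring\<^esub> \<iota> c"
    unfolding algebra_map_def by blast+
  from h show "\<iota> 1 = 1" "\<iota> (a + b) = \<iota> a + \<iota> b" "\<iota> (a * b) = \<iota> a * \<iota> b" for a b
    by (simp_all add: ring_hom_type_ring)
  show "\<iota> c * z = z * \<iota> c" for c z
    using c[rule_format, of z c] by (simp add: type_ring_def)
  \<comment> \<open>A specialization sends 0 to 0, so generators that can be sent to 1 are
    nonzero.\<close>
  obtain L f where "partial_hom \<iota> L f" "f X = 1" "f Y = 1"
    using free_skew_field_specialize[OF free, of 1 1] by metis
  then show "X \<noteq> 0" "Y \<noteq> 0" using partial_hom_zero[of \<iota> L f] by auto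
qed

lemma \<iota>_sum: "\<iota> (\<Sum>i\<in>I. f i) = (\<Sum>i\<in>I. \<iota> (f i))"
  by (induction I rule: infinite_finite_induct) (simp_all add: \<iota>_zero \<iota>_add)

lemma \<iota>_power: "\<iota> (a ^ n) = \<iota> a ^ n"
  by (induction n) (simp_all add: \<iota>_one \<iota>_mult)

text \<open>In characteristic zero the field is infinite, so P has a non-root c; specializing both
  generators to c gives a nonzero scalar.\<close>

lemma poly_at_nonzero:
  assumes "P \<noteq> 0"
  shows "poly_at \<iota> P X \<noteq> 0" "poly_at \<iota> P Y \<noteq> 0"
proof -
  obtain c where c: "poly P c \<noteq> 0" using assms poly_all_0_iff_0 by blast
  obtain L f where f: "partial_hom \<iota> L f" "X \<in> L" "Y \<in> L" "f X = \<iota> c" "f Y = \<iota> c"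
    using free_skew_field_specialize[OF free] by metis
  have "\<iota> (poly P c) * \<iota> (inverse (poly P c)) = 1"
    using c by (simp add: \<iota>_one flip: \<iota>_mult)
  then have "\<iota> (poly P c) \<noteq> 0" by auto
  moreover have "poly_at \<iota> P (\<iota> c) = \<iota> (poly P c)"
    by (simp add: poly_at_def poly_altdef \<iota>_sum \<iota>_mult \<iota>_power)
  ultimately have "f (poly_at \<iota> P X) \<noteq> 0" "f (poly_at \<iota> P Y) \<noteq> 0"
    using partial_hom_poly_at(2)[OF f(1)] f by auto
  then show "poly_at \<iota> P X \<noteq> 0" "poly_at \<iota> P Y \<noteq> 0"
    using partial_hom_zero[OF f(1)] by auto
qed

lemma poly_at_conj:
  assumes "u \<noteq> 0"
  shows "poly_at \<iota> P (u * z * inverse u) = u * poly_at \<iota> P z * inverse u"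
proof -
  have u: "inverse u * (u * t) = t" for t
    using assms by (simp flip: mult.assoc)
  have "(u * z * inverse u) ^ i = u * z ^ i * inverse u" for i
    using assms by (induction i) (simp_all add: mult.assoc u)
  then show ?thesis
    by (simp add: poly_at_def sum_distrib_left sum_distrib_right \<iota>_left[of u] mult.assoc)
qed

lemma poly_at_commute: "poly_at \<iota> P z * z = z * poly_at \<iota> P z"
  by (simp add: poly_at_def sum_distrib_left sum_distrib_right \<iota>_left[of z] mult.assoc
      power_commutes)

text \<open>The specialization to the prescribed images and the one to the images under the inverse compose
  to specializations fixing \<open>X\<close> and \<open>Y\<close>; these are the identity, so both are defined everywhere.\<close>

lemma automorphism_exists:
  assumes P: "P \<noteq> 0"
  obtains \<phi> where "fixing_hom \<phi>" "bij \<phi>" "\<phi> X = X * Y * inverse X" "\<phi> Y = poly_at \<iota> P Y * inverse X"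
proof -
  note nz = poly_at_nonzero[OF P] X_nz Y_nz
  have c: "poly_at \<iota> P X * (inverse (poly_at \<iota> P X) * z) = z"
    "poly_at \<iota> P Y * (inverse (poly_at \<iota> P Y) * z) = z" for z
    using nz by (simp_all flip: mult.assoc)
  obtain L f where f: "partial_hom \<iota> L f" and fL: "X \<in> L" "Y \<in> L"
    and fX: "f X = X * Y * inverse X" and fY: "f Y = poly_at \<iota> P Y * inverse X"
    by (rule free_skew_field_specialize[OF free])
  \<comment> \<open>These images of X and Y are those of the inverse of \<open>F\<close>, found by
    solving its defining equations for X and Y.\<close>
  obtain M g where g: "partial_hom \<iota> M g" and gM: "X \<in> M" "Y \<in> M"
    and gX: "g X = poly_at \<iota> P X * inverse Y" and gY: "g Y = Y * X * inverse Y"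
    by (rule free_skew_field_specialize[OF free])
  have gf: "f X \<in> M" "g (f X) = X" "f Y \<in> M" "g (f Y) = Y"
  proof -
    have gX0: "g X \<noteq> 0" using nz gX by simp
    note gs = partial_hom_mult[OF g] partial_hom_inverse[OF g gM(1) gX0] partial_hom_poly_at[OF g gM(2)] gM
    show "f X \<in> M" "f Y \<in> M" by (simp_all add: fX fY gs)
    have "g (f X) = poly_at \<iota> P X * X * inverse (poly_at \<iota> P X)"
      using nz by (simp add: fX gs gX gY nonzero_inverse_mult_distrib mult.assoc cancel)
    then show "g (f X) = X" using nz by (simp add: poly_at_commute mult.assoc)
    have "g (f Y) = poly_at \<iota> P (Y * X * inverse Y) * (Y * inverse (poly_at \<iota> P X))"
      using nz by (simp add: fY gs gX gY nonzero_inverse_mult_distrib)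
    then show "g (f Y) = Y" unfolding poly_at_conj[OF Y_nz] using nz by (simp add: mult.assoc cancel)
  qed
  have fg: "g X \<in> L" "f (g X) = X" "g Y \<in> L" "f (g Y) = Y"
  proof -
    have fY0: "f Y \<noteq> 0" using nz fY by simp
    note fs = partial_hom_mult[OF f] partial_hom_inverse[OF f fL(2) fY0] partial_hom_poly_at[OF f fL(1)] fL
    show "g X \<in> L" "g Y \<in> L" by (simp_all add: gX gY fs)
    have "f (g X) = poly_at \<iota> P (X * Y * inverse X) * (X * inverse (poly_at \<iota> P Y))"
      using nz by (simp add: gX fs fX fY nonzero_inverse_mult_distrib)
    then show "f (g X) = X" unfolding poly_at_conj[OF X_nz] using nz by (simp add: mult.assoc cancel)
    have "f (g Y) = poly_at \<iota> P Y * Y * inverse (poly_at \<iota> P Y)"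
      using nz by (simp add: gY fs fX fY nonzero_inverse_mult_distrib mult.assoc cancel)
    then show "f (g Y) = Y" using nz by (simp add: poly_at_commute mult.assoc)
  qed
  have 1: "{x \<in> L. f x \<in> M} = UNIV" "\<And>x. (g \<circ> f) x = x"
    using partial_hom_eq_id[OF partial_hom_comp[OF f g] generates] fL gf by auto
  have 2: "{x \<in> M. g x \<in> L} = UNIV" "\<And>x. (f \<circ> g) x = x"
    using partial_hom_eq_id[OF partial_hom_comp[OF g f] generates] gM fg by auto
  have "x \<in> L" for x using 1(1) by blast
  then have "fixing_hom f"
    using partial_hom_add[OF f] partial_hom_mult[OF f] partial_hom_\<iota>[OF f]
    by (simp add: fixing_hom_def)
  moreover have "bij f" using 1(2) 2(2) by (intro o_bij[of g]) (auto simp: fun_eq_iff)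
  ultimately show ?thesis using that fX fY by blast
qed

lemma fixing_hom_unique:
  assumes "fixing_hom \<phi>" "fixing_hom \<psi>" "\<phi> X = \<psi> X" "\<phi> Y = \<psi> Y"
  shows "\<phi> = \<psi>"
proof -
  let ?S = "{x. \<phi> x = \<psi> x}"
  have d: "\<chi> (x - y) = \<chi> x - \<chi> y" if "fixing_hom \<chi>" for \<chi> x y
    using hom_add[OF that, of "x - y" y] by (simp add: algebra_simps)
  have "range \<iota> \<subseteq> ?S" by (auto simp: hom_\<iota>[OF assms(1)] hom_\<iota>[OF assms(2)])
  then have "?S = UNIV"
    using generates[unfolded generates_skew_field_def, rule_format, of ?S] assms
    by (simp add: hom_mult hom_inverse d)
  then show ?thesis by auto
qed

lemma linear_automorphism_iff: "linear_automorphism \<iota> \<phi> \<longleftrightarrow> fixing_hom \<phi> \<and> bij \<phi>"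
proof
  assume l: "linear_automorphism \<iota> \<phi>"
  then have "\<phi> 1 = 1" "\<And>c x. \<phi> (\<iota> c * x) = \<iota> c * \<phi> x"
    by (auto simp: linear_automorphism_def ring_hom_type_ring)
  then have "\<phi> (\<iota> c) = \<iota> c" for c by (metis mult.right_neutral)
  with l show "fixing_hom \<phi> \<and> bij \<phi>"
    by (auto simp: linear_automorphism_def ring_hom_type_ring fixing_hom_def)
next
  assume "fixing_hom \<phi> \<and> bij \<phi>"
  then show "linear_automorphism \<iota> \<phi>"
    by (auto simp: linear_automorphism_def ring_hom_type_ring hom_add hom_mult hom_one hom_\<iota>)
qed

text \<open>Existence and uniqueness together make the definite description in \<open>F\<close>
  denote the intended automorphism.\<close>

lemma
  assumes P: "P \<noteq> 0"
  shows F_hom: "fixing_hom (F \<iota> X Y P)" and F_X: "F \<iota> X Y P X = X * Y * inverse X"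
    and F_Y: "F \<iota> X Y P Y = poly_at \<iota> P Y * inverse X"
proof -
  let ?p = "\<lambda>\<phi>. linear_automorphism \<iota> \<phi> \<and> \<phi> X = X * Y * inverse X \<and> \<phi> Y = poly_at \<iota> P Y * inverse X"
  obtain \<phi> where "?p \<phi>" using automorphism_exists[OF P] linear_automorphism_iff by metis
  moreover have "\<psi> = \<phi>" if "?p \<psi>" for \<psi>
    using fixing_hom_unique[of \<psi> \<phi>] that \<open>?p \<phi>\<close> by (simp add: linear_automorphism_iff)
  ultimately have "?p (F \<iota> X Y P)" unfolding F_def by (rule theI)
  then show "fixing_hom (F \<iota> X Y P)" "F \<iota> X Y P X = X * Y * inverse X"
    "F \<iota> X Y P Y = poly_at \<iota> P Y * inverse X"
    by (simp_all add: linear_automorphism_iff)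
qed

subsection \<open>Paths for the iterated automorphisms\<close>

text \<open>\<open>Q k\<close> plays the role of P_(k+1). Monicity is included: the constant term of
  \<open>Q (k + 2)\<close> is the leading coefficient of \<open>Q k\<close>.\<close>

definition alternating :: "(nat \<Rightarrow> 'k poly) \<Rightarrow> bool" where
  "alternating Q \<longleftrightarrow> (\<forall>k. Q (k + 2) = reflect_poly (Q k) \<and> coeff (Q k) 0 = 1)"

abbreviation shift :: "(nat \<Rightarrow> 'k poly) \<Rightarrow> nat \<Rightarrow> 'k poly" where
  "shift Q \<equiv> (\<lambda>k. Q (Suc k))"

lemma
  assumes "alternating Q"
  shows alternating_shift: "alternating (shift Q)"
    and alternating_const: "coeff (Q k) 0 = 1" and alternating_nz: "Q k \<noteq> 0"
    and alternating_reflect: "Q (Suc (Suc k)) = reflect_poly (Q k)"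
    and alternating_reflect': "reflect_poly (Q (Suc (Suc k))) = Q k"
    and alternating_degree: "degree (Q (Suc (Suc k))) = degree (Q k)"
    and alternating_deg0: "degree (Q k) = 0 \<Longrightarrow> Q k = 1"
proof -
  show "alternating (shift Q)"
    using assms unfolding alternating_def by simp
  show c: "coeff (Q k) 0 = 1" using assms unfolding alternating_def by simp
  then show "Q k \<noteq> 0" by auto
  show r: "Q (Suc (Suc k)) = reflect_poly (Q k)"
    using assms unfolding alternating_def by (metis add_2_eq_Suc')
  show "reflect_poly (Q (Suc (Suc k))) = Q k" "degree (Q (Suc (Suc k))) = degree (Q k)"
    unfolding r using c by simp_all
  show "Q k = 1" if "degree (Q k) = 0"
    using c by (rule_tac degree_eq_zeroE[OF that]) (simp add: one_pCons)
qed

primrec F_prod :: "(nat \<Rightarrow> 'k poly) \<Rightarrow> nat \<Rightarrow> 'a \<Rightarrow> 'a" where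
  "F_prod Q 0 z = z"
| "F_prod Q (Suc n) z = F_prod Q n (F \<iota> X Y (Q n) z)"

text \<open>The inductions peel off the outermost automorphism; what remains belongs to the shifted
  sequence.\<close>

lemma F_prod_Suc: "F_prod Q (Suc n) z = F \<iota> X Y (Q 0) (F_prod (shift Q) n z)"
  by (induction n arbitrary: z) simp_all

text \<open>\<open>Z\<close> is the image of X under every \<open>F\<close>, and \<open>C\<close> is
  the commutator of X and Y, so that C Y = Z.\<close>

abbreviation Z :: 'a where "Z \<equiv> X * Y * inverse X"
abbreviation C :: 'a where "C \<equiv> X * Y * inverse X * inverse Y"

definition has_path :: "(nat \<Rightarrow> 'k poly) \<Rightarrow> nat \<Rightarrow> bool list \<Rightarrow> bool" where
  "has_path Q n w \<longleftrightarrow>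
     F_prod Q n Y = X * path_sum (Q 0) (reflect_poly (Q (Suc 0))) w * inverse X"

text \<open>Writing Q_0(Y) X^-1 as X (X^-1 Q_0(Y)) X^-1 exhibits the single step h.\<close>

lemma has_path_one: "alternating Q \<Longrightarrow> has_path Q (Suc 0) (blocks [0])"
  by (simp add: has_path_def blocks_def path_sum_h F_Y alternating_nz cancel mult.assoc)

text \<open>The shifted sequence has path polynomials \<open>Q 1\<close> and the reflection of
  \<open>Q 2\<close>, which is \<open>Q 0\<close>. This is the pair that
  \<open>mutate_path_sum\<close> expects for the automorphism of \<open>Q 0\<close>.\<close>

lemma has_path_Suc:
  assumes Q: "alternating Q" and w: "has_path (shift Q) n (blocks cs)"
    and cs: "\<forall>c\<in>set cs. c \<le> degree (Q (Suc 0))"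
  shows "has_path Q (Suc n) (mutate_path (degree (Q (Suc 0))) cs)"
proof -
  have "F_prod Q (Suc n) Y =
      F \<iota> X Y (Q 0) (X * path_sum (Q (Suc 0)) (Q 0) (blocks cs) * inverse X)"
    using w unfolding F_prod_Suc has_path_def by (simp add: alternating_reflect'[OF Q])
  also have "\<dots> = X * path_sum (Q 0) (reflect_poly (Q (Suc 0)))
      (mutate_path (degree (Q (Suc 0))) cs) * inverse X"
    using alternating_nz[OF Q] alternating_const[OF Q] cs
    by (intro mutate_path_sum F_hom F_X F_Y poly_at_nonzero) auto
  finally show ?thesis unfolding has_path_def .
qed

section \<open>Shapes of paths under mutation\<close>

lemma blocks_simps: "blocks [] = []" "blocks (c # cs) = True # replicate c False @ blocks cs"
  by (simp_all add: blocks_def)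

lemma blocks_append: "blocks (as @ bs) = blocks as @ blocks bs"
  by (simp add: blocks_def)

lemma mutate_path_simps: "mutate_path d [] = []"
    "mutate_path d (c # cs) = replicate (d - c) True @ False # mutate_path d cs"
  by (simp_all add: mutate_path_def)

lemma mutate_path_append: "mutate_path d (as @ bs) = mutate_path d as @ mutate_path d bs"
  by (simp add: mutate_path_def)

text \<open>Block exponents of the path h^n_1 v h^n_2 v ... with all n_i positive.\<close>

definition runs :: "nat list \<Rightarrow> nat list" where
  "runs ns = concat (map (\<lambda>n. replicate (n - 1) 0 @ [1]) ns)"

text \<open>Strict inequality makes every power of h nonempty, so each v follows an h and the image
  is again a sequence of blocks.\<close>

lemma mutate_path_runs:
  "\<forall>c\<in>set cs. c < d \<Longrightarrow> mutate_path d cs = blocks (runs (map (\<lambda>c. d - c) cs))"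
proof (induction cs)
  case (Cons c cs)
  then obtain k where k: "d - c = Suc k" by (cases "d - c") auto
  have "replicate (Suc k) True @ [False] = blocks (replicate k 0 @ [1])"
    by (induction k) (simp_all add: blocks_def)
  then show ?case
    using Cons by (simp add: mutate_path_def runs_def blocks_append blocks_simps k del: replicate.simps)
qed (simp add: mutate_path_def runs_def blocks_def)

text \<open>For d = 1, exponent 0 becomes h v and exponent 1 becomes v. Thus a run turns into (h
  v)^(n-1) v, whose last v joins the preceding block; this requires n >= 2.\<close>

lemma mutate_path_one_runs:
  "\<forall>n\<in>set ns. 2 \<le> n \<Longrightarrow> mutate_path 1 (runs ns) = blocks (concat (map (\<lambda>n. replicate (n - 2) 1 @ [2]) ns))"
proof (induction ns)
  case (Cons n ns)
  then obtain k where k: "n = Suc (Suc k)" by (metis Suc_le_D numeral_2_eq_2 list.set_intros(1) Suc_le_mono)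
  have "mutate_path 1 (replicate (Suc k) 0 @ [1]) = blocks (replicate k 1 @ [2])"
    by (induction k) (simp_all add: blocks_def mutate_path_def numeral_2_eq_2)
  then show ?case
    using Cons by (simp add: runs_def blocks_append blocks_simps mutate_path_append mutate_path_simps k del: replicate_Suc)
qed (simp add: mutate_path_def runs_def blocks_def)

text \<open>Exponents 0 and 1 lie strictly below both degrees, and mutation produces runs, which
  again contain only these exponents.\<close>

lemma has_path_ge2:
  assumes "alternating Q" "degree (Q 0) \<ge> 2" "degree (Q (Suc 0)) \<ge> 2"
  shows "\<exists>cs. set cs \<subseteq> {0, 1} \<and> has_path Q (Suc n) (blocks cs)"
  using assms
proof (induction n arbitrary: Q)
  case 0
  then show ?case using has_path_one by (intro exI[of _ "[0]"]) simp
next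
  case (Suc n)
  let ?d = "degree (Q (Suc 0))"
  obtain cs where cs: "set cs \<subseteq> {0, 1}" "has_path (shift Q) (Suc n) (blocks cs)"
    using Suc.IH[of "shift Q"] Suc.prems by (auto simp: alternating_shift alternating_degree)
  then have lt: "\<forall>c\<in>set cs. c < ?d" using Suc.prems by auto
  then have "has_path Q (Suc (Suc n)) (blocks (runs (map (\<lambda>c. ?d - c) cs)))"
    using has_path_Suc[OF Suc.prems(1) cs(2)] mutate_path_runs[OF lt] lt by (simp add: less_imp_le)
  moreover have "set (runs ns) \<subseteq> {0, 1}" for ns
    by (auto simp: runs_def)
  ultimately show ?case by blast
qed

text \<open>The invariant alternates. Degree d >= 4 sends exponents at most 2 to runs of lengths d -
  c >= 2, and degree 1 sends such runs to exponents 1 and 2. The initial path h is the exception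
  \<open>[0]\<close>.\<close>

lemma has_path_one_four:
  assumes "alternating Q" "degree (Q 0) = 1 \<and> degree (Q (Suc 0)) \<ge> 4 \<or> degree (Q 0) \<ge> 4 \<and> degree (Q (Suc 0)) = 1"
  shows "\<exists>cs. has_path Q (Suc n) (blocks cs) \<and> (if degree (Q 0) = 1 then cs = [0] \<or>
      (\<exists>ns. cs = runs ns \<and> (\<forall>n\<in>set ns. 2 \<le> n)) else set cs \<subseteq> {0, 1, 2})"
  using assms
proof (induction n arbitrary: Q)
  case 0
  then show ?case using has_path_one by (intro exI[of _ "[0]"]) simp
next
  case (Suc n)
  let ?d = "degree (Q (Suc 0))"
  obtain cs where p: "has_path (shift Q) (Suc n) (blocks cs)"
    and cs: "if ?d = 1 then cs = [0] \<or> (\<exists>ns. cs = runs ns \<and> (\<forall>n\<in>set ns. 2 \<le> n)) else set cs \<subseteq> {0, 1, 2}"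
    using Suc.IH[of "shift Q"] Suc.prems by (auto simp: alternating_shift alternating_degree)
  show ?case
  proof (cases "?d = 1")
    case True
    then have d0: "degree (Q 0) \<noteq> 1" using Suc.prems by auto
    from True cs consider "cs = [0]" | ns where "cs = runs ns" "\<forall>n\<in>set ns. 2 \<le> n" by auto
    then show ?thesis
    proof cases
      case 1
      then have "has_path Q (Suc (Suc n)) (blocks [1])"
        using has_path_Suc[OF Suc.prems(1) p] True by (simp add: mutate_path_def blocks_def)
      then show ?thesis using d0 by (intro exI[of _ "[1]"]) simp
    next
      case 2
      let ?cs = "concat (map (\<lambda>n. replicate (n - 2) 1 @ [2]) ns) :: nat list"
      have "\<forall>c\<in>set cs. c \<le> ?d" unfolding True 2(1) by (auto simp: runs_def)
      then have "has_path Q (Suc (Suc n)) (blocks ?cs)"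
        using has_path_Suc[OF Suc.prems(1) p] True mutate_path_one_runs[OF 2(2)] 2(1) by simp
      moreover have "set ?cs \<subseteq> {0, 1, 2}" by auto
      ultimately show ?thesis using d0 by (intro exI[of _ ?cs]) simp
    qed
  next
    case False
    then have d: "?d \<ge> 4" "degree (Q 0) = 1" using Suc.prems by auto
    from False cs have cs': "set cs \<subseteq> {0, 1, 2}" by simp
    have lt: "\<forall>c\<in>set cs. c < ?d" using cs' d by auto
    then have "has_path Q (Suc (Suc n)) (blocks (runs (map (\<lambda>c. ?d - c) cs)))"
      using has_path_Suc[OF Suc.prems(1) p] mutate_path_runs[OF lt] lt by (simp add: less_imp_le)
    moreover have "\<exists>ns. runs (map (\<lambda>c. ?d - c) cs) = runs ns \<and> (\<forall>n\<in>set ns. 2 \<le> n)"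
      using cs' d by (intro exI[of _ "map (\<lambda>c. ?d - c) cs"]) auto
    ultimately have "has_path Q (Suc (Suc n)) (blocks (runs (map (\<lambda>c. ?d - c) cs))) \<and>
        (runs (map (\<lambda>c. ?d - c) cs) = [0] \<or>
          (\<exists>ns. runs (map (\<lambda>c. ?d - c) cs) = runs ns \<and> (\<forall>n\<in>set ns. 2 \<le> n)))"
      by blast
    then show ?thesis unfolding d(2) if_P[OF refl] by (rule exI)
  qed
qed

subsection \<open>Finite types\<close>

lemma F_Z: "P \<noteq> 0 \<Longrightarrow> F \<iota> X Y P Z = Z * (poly_at \<iota> P Y * inverse X) * inverse Z"
  by (simp add: hom_mult[OF F_hom] hom_inverse[OF F_hom] F_X F_Y)

text \<open>The factors X of \<open>S\<close>, which is the image of Y, undo the conjugation in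
  \<open>Z\<close>; then P(Y) commutes with Y.\<close>

lemma conj_Z:
  assumes "P \<noteq> 0"
  defines "S \<equiv> poly_at \<iota> P Y * inverse X"
  shows "S * Z * inverse S = Y" "S * inverse Z * inverse S = inverse Y"
proof -
  have "poly_at \<iota> P Y * Y * inverse (poly_at \<iota> P Y) = Y"
    using poly_at_nonzero[OF assms(1)] by (simp add: poly_at_commute mult.assoc)
  then show 1: "S * Z * inverse S = Y"
    using poly_at_nonzero[OF assms(1)] X_nz
    by (simp add: S_def nonzero_inverse_mult_distrib mult.assoc cancel)
  have "S \<noteq> 0" "Z \<noteq> 0" using poly_at_nonzero[OF assms(1)] X_nz Y_nz by (simp_all add: S_def)
  then have "inverse (S * Z * inverse S) = S * inverse Z * inverse S"
    by (simp add: nonzero_inverse_mult_distrib mult.assoc)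
  then show "S * inverse Z * inverse S = inverse Y" unfolding 1 ..
qed

text \<open>With S the image of Y, the image of C is Z S Z^-1 S^-1, and \<open>conj_Z\<close>
  replaces S Z^-1 S^-1 by Y^-1.\<close>

lemma F_C: "P \<noteq> 0 \<Longrightarrow> F \<iota> X Y P C = C"
proof -
  assume P: "P \<noteq> 0"
  let ?S = "poly_at \<iota> P Y * inverse X"
  have "F \<iota> X Y P C = F \<iota> X Y P Z * inverse (F \<iota> X Y P Y)"
    by (simp only: hom_mult[OF F_hom[OF P]] hom_inverse[OF F_hom[OF P]])
  also have "\<dots> = Z * (?S * inverse Z * inverse ?S)"
    unfolding F_Z[OF P] F_Y[OF P] by (simp only: mult.assoc)
  also have "\<dots> = C" unfolding conj_Z(2)[OF P] by (simp only: mult.assoc)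
  finally show ?thesis .
qed

text \<open>The path v does not start with h, so mutation stops here. Instead the polynomials
  cancel: Q_0(Z) = X Q_0(Y) X^-1 meets the inverse of Q_0(Y) X^-1.\<close>

lemma F_v:
  assumes Q: "alternating Q" and p: "has_path (shift Q) n [False]"
  shows "F_prod Q (Suc n) Y = Z * X * inverse Z"
proof -
  note nz = alternating_nz[OF Q, of 0]
  have "F_prod Q (Suc n) Y =
      F \<iota> X Y (Q 0) (X * (poly_at \<iota> (Q 0) X * inverse Y) * inverse X)"
    using p unfolding F_prod_Suc has_path_def
    by (simp add: alternating_reflect'[OF Q] path_sum_v)
  also have "\<dots> = Z * (poly_at \<iota> (Q 0) Z * inverse (poly_at \<iota> (Q 0) Y * inverse X)) * inverse Z"
    by (simp only: hom_mult[OF F_hom[OF nz]] hom_inverse[OF F_hom[OF nz]] hom_poly_at[OF F_hom[OF nz]]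
        F_X[OF nz] F_Y[OF nz])
  also have "poly_at \<iota> (Q 0) Z * inverse (poly_at \<iota> (Q 0) Y * inverse X) = X"
    unfolding poly_at_conj[OF X_nz] using poly_at_nonzero[OF nz] X_nz
    by (simp add: nonzero_inverse_mult_distrib mult.assoc cancel)
  finally show ?thesis .
qed

lemma hom_conj: "fixing_hom G \<Longrightarrow> G (u * z * inverse u) = G u * G z * inverse (G u)"
  by (simp add: hom_mult hom_inverse)

lemma Z_nz: "Z \<noteq> 0"
  using X_nz Y_nz by simp_all

text \<open>Applying \<open>conj_Z\<close> gives Z Y Z^-1, and Z = C Y turns this into a conjugate
  by C. Together with \<open>F_v\<close> this closes the cycle.\<close>

lemma F_ZXZ:
  assumes P: "P \<noteq> 0"
  shows "F \<iota> X Y P (Z * X * inverse Z) = C * Y * inverse C"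
proof -
  let ?S = "poly_at \<iota> P Y * inverse X"
  have S: "?S \<noteq> 0" using poly_at_nonzero[OF P] X_nz by simp
  have "F \<iota> X Y P (Z * X * inverse Z) = (Z * ?S * inverse Z) * Z * inverse (Z * ?S * inverse Z)"
    by (simp only: hom_mult[OF F_hom[OF P]] hom_inverse[OF F_hom[OF P]] F_X[OF P] F_Y[OF P])
  also have "\<dots> = Z * (?S * (inverse Z * Z) * Z * inverse ?S) * inverse Z"
  proof -
    have "inverse (Z * ?S * inverse Z) = Z * inverse ?S * inverse Z"
      by (subst nonzero_inverse_mult_distrib, use S Z_nz in simp, use S Z_nz in simp,
          subst nonzero_inverse_mult_distrib[OF Z_nz S]) (simp only: inverse_inverse_eq mult.assoc)
    then show ?thesis by (simp only: mult.assoc)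
  qed
  also have "\<dots> = Z * (?S * Z * inverse ?S) * inverse Z"
    unfolding left_inverse[OF Z_nz] by (simp only: mult_1_right)
  also have "\<dots> = Z * Y * inverse Z" unfolding conj_Z(1)[OF P] ..
  also have "\<dots> = C * Y * inverse C"
  proof -
    have "inverse (Z * inverse Y) = Y * inverse Z"
      using Y_nz Z_nz by (subst nonzero_inverse_mult_distrib) auto
    then have "C * Y * inverse C = Z * (inverse Y * (Y * (Y * inverse Z)))"
      by (simp only: mult.assoc)
    then show ?thesis by (simp only: cancel mult.assoc)
  qed
  finally show ?thesis .
qed

lemma F_prod_v:
  assumes Q: "alternating Q" and p: "has_path (shift (shift Q)) n [False]"
  shows "F_prod Q (Suc (Suc n)) Y = C * Y * inverse C"
  unfolding F_prod_Suc[of Q] F_v[OF alternating_shift[OF Q] p] by (rule F_ZXZ[OF alternating_nz[OF Q]])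

section \<open>Periodicity for small pairs of degrees\<close>

definition degrees :: "nat \<Rightarrow> nat \<Rightarrow> (nat \<Rightarrow> 'k poly) \<Rightarrow> bool" where
  "degrees a b Q \<longleftrightarrow> alternating Q \<and>
     (degree (Q 0) = a \<and> degree (Q (Suc 0)) = b \<or> degree (Q 0) = b \<and> degree (Q (Suc 0)) = a)"

lemma degrees_shift: "degrees a b Q \<Longrightarrow> degrees a b (shift Q)"
  unfolding degrees_def using alternating_shift alternating_degree by auto

text \<open>Shifting exchanges the two degrees, so the path for one order arises by mutating the
  previous path for the other order. For a = b there is only one order.\<close>

lemma degrees_step:
  assumes IH: "\<And>Q. degrees a b Q \<Longrightarrow> has_path Q n (blocks (if degree (Q (Suc 0)) = a then cs else ds))"
    and Q: "degrees a b Q" and le: "\<forall>c\<in>set cs. c \<le> b" "\<forall>d\<in>set ds. d \<le> a"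
  shows "has_path Q (Suc n) (if degree (Q (Suc 0)) = a then
    mutate_path a (if a = b then cs else ds) else mutate_path b cs)"
proof -
  have a: "alternating Q" using Q by (simp add: degrees_def)
  have d2: "degree (Q (Suc (Suc 0))) = degree (Q 0)" by (rule alternating_degree[OF a])
  have p: "has_path (shift Q) n (blocks (if degree (Q (Suc (Suc 0))) = a then cs else ds))"
    using IH[OF degrees_shift[OF Q]] by simp
  show ?thesis
    using has_path_Suc[OF a p] Q le unfolding degrees_def d2 by (auto split: if_splits)
qed

text \<open>Every \<open>F\<close> fixes C, so conjugation by C passes out through all remaining
  automorphisms.\<close>

lemma periodic:
  assumes per: "\<And>Q. degrees a b Q \<Longrightarrow> F_prod Q h Y = C * Y * inverse C"
    and Q: "degrees a b Q"
  shows "F_prod Q (n + h) Y = C * F_prod Q n Y * inverse C"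
  using Q
proof (induction n arbitrary: Q)
  case 0
  then show ?case using per by simp
next
  case (Suc n)
  have nz: "Q 0 \<noteq> 0" using Suc.prems alternating_nz by (auto simp: degrees_def)
  have "F_prod Q (Suc n + h) Y = F \<iota> X Y (Q 0) (C * F_prod (shift Q) n Y * inverse C)"
    using Suc.IH[OF degrees_shift[OF Suc.prems]] by (simp only: F_prod_Suc add_Suc)
  also have "\<dots> = C * F_prod Q (Suc n) Y * inverse C"
    by (simp only: hom_conj[OF F_hom[OF nz]] F_C[OF nz] F_prod_Suc)
  finally show ?case .
qed

definition coeffs_in :: "'k set \<Rightarrow> (nat \<Rightarrow> 'k poly) \<Rightarrow> bool" where
  "coeffs_in S Q \<longleftrightarrow> semiring_set S \<and> (\<forall>k i. coeff (Q k) i \<in> S)"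

lemma C_ev: "C = ev [XP, YP, XM, YM]" and inverse_C_ev: "inverse C = ev [YP, XP, YM, XM]"
  and inverse_Z_ev: "inverse Z = ev [XP, YM, XM]"
  using X_nz Y_nz by (simp_all add: nonzero_inverse_mult_distrib mult.assoc)

lemma laurent_conj_C: "x \<in> laurent S \<Longrightarrow> C * x * inverse C \<in> laurent S"
  unfolding inverse_C_ev unfolding C_ev by (intro laurent_mult_ev laurent_ev_mult)

lemma has_path_laurent:
  assumes "coeffs_in S Q" "has_path Q n w"
  shows "F_prod Q n Y \<in> laurent S"
proof -
  have "coeff (reflect_poly (Q (Suc 0))) i \<in> S" for i
    using assms(1) by (simp add: coeffs_in_def coeff_reflect_poly semiring_set_def)
  then have "path_sum (Q 0) (reflect_poly (Q (Suc 0))) w \<in> laurent S"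
    using assms(1) by (intro laurent_path_sum) (auto simp: coeffs_in_def)
  then have "ev [XP] * path_sum (Q 0) (reflect_poly (Q (Suc 0))) w * ev [XM] \<in> laurent S"
    by (intro laurent_mult_ev laurent_ev_mult)
  then show ?thesis using assms(2) by (simp add: has_path_def)
qed

lemma laurent_Y: "semiring_set S \<Longrightarrow> Y \<in> laurent S"
  using laurent_ev[of S "[YP]"] by simp

lemma laurent_ZXZ:
  assumes "semiring_set S"
  shows "Z * X * inverse Z \<in> laurent S"
proof -
  have "Z * X * inverse Z = ev [XP, YP, XM, XP, XP, YM, XM]"
    using X_nz Y_nz by (simp add: nonzero_inverse_mult_distrib mult.assoc cancel)
  then show ?thesis using laurent_ev[OF assms] by metis
qed

text \<open>If the path is v after h steps, then step h + 1 gives Z X Z^-1, and from step h + 2 on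
  the values repeat up to conjugation by C.\<close>

lemma finite_type:
  assumes paths: "\<And>Q n. degrees a b Q \<Longrightarrow> 0 < n \<Longrightarrow> n \<le> h \<Longrightarrow> \<exists>w. has_path Q n w"
    and last: "\<And>Q. degrees a b Q \<Longrightarrow> has_path Q h [False]"
    and Q: "degrees a b Q" and S: "coeffs_in S Q"
  shows "F_prod Q n Y \<in> laurent S"
proof -
  have a: "alternating Q" using Q by (simp add: degrees_def)
  have S': "semiring_set S" using S by (simp add: coeffs_in_def)
  show ?thesis
  proof (induction n rule: less_induct)
    case (less n)
    consider "n = 0" | "0 < n" "n \<le> h" | "n = Suc h" | m where "n = m + Suc (Suc h)"
      by (metis gr0I less_Suc_eq_le linorder_not_less add.commute le_Suc_ex not_less_eq_eq le_antisym)
    then show ?case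
    proof cases
      case 1
      then show ?thesis using laurent_Y[OF S'] by simp
    next
      case 2
      then show ?thesis using paths[OF Q] has_path_laurent[OF S] by blast
    next
      case 3
      then show ?thesis
        using F_v[OF a last[OF degrees_shift[OF Q]]] laurent_ZXZ[OF S'] by simp
    next
      case 4
      have "F_prod Q n Y = C * F_prod Q m Y * inverse C"
        unfolding 4
      proof (rule periodic[OF _ Q])
        fix R
        assume R: "degrees a b R"
        then show "F_prod R (Suc (Suc h)) Y = C * Y * inverse C"
          using F_prod_v last[OF degrees_shift[OF degrees_shift[OF R]]] by (simp add: degrees_def)
      qed
      then show ?thesis using laurent_conj_C[OF less(1)[of m]] 4 by simp
    qed
  qed
qed

text \<open>The path is v after 3 steps, giving period 5 up to conjugation, as for the cluster type
  A_2.\<close>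

lemma laurent_1_1:
  assumes "degrees 1 1 Q" "coeffs_in S Q"
  shows "F_prod Q n Y \<in> laurent S"
proof -
  have 1: "has_path Q (Suc 0) (blocks [0])" if "degrees 1 1 Q" for Q
    using that has_path_one by (simp add: degrees_def)
  have 2: "has_path Q (Suc (Suc 0)) (blocks [1])" if "degrees 1 1 Q" for Q
    using degrees_step[of 1 1 "Suc 0" "[0]" "[0]", OF _ that] 1 that
    by (simp add: degrees_def mutate_path_simps blocks_simps)
  have 3: "has_path Q (Suc (Suc (Suc 0))) [False]" if "degrees 1 1 Q" for Q
    using degrees_step[of 1 1 "Suc (Suc 0)" "[1]" "[1]", OF _ that] 2 that
    by (simp add: degrees_def mutate_path_simps blocks_simps)
  have "\<exists>w. has_path Q n w" if "degrees 1 1 Q" "0 < n" "n \<le> Suc (Suc (Suc 0))" for Q n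
  proof -
    have "n = Suc 0 \<or> n = Suc (Suc 0) \<or> n = Suc (Suc (Suc 0))" using that by auto
    then show ?thesis using 1 2 3 that(1) by blast
  qed
  then show ?thesis using finite_type[OF _ 3 assms] by blast
qed

text \<open>The path is v after 4 steps for both orders of the degrees, giving period 6, as for
  B_2.\<close>

lemma laurent_1_2:
  assumes "degrees 1 2 Q" "coeffs_in S Q"
  shows "F_prod Q n Y \<in> laurent S"
proof -
  let ?c = "\<lambda>Q :: nat \<Rightarrow> 'k poly. degree (Q (Suc 0)) = 1"
  note simps = mutate_path_simps blocks_simps numeral_2_eq_2
  have 1: "has_path Q (Suc 0) (blocks (if ?c Q then [0] else [0]))" if "degrees 1 2 Q" for Q
    using that has_path_one by (simp add: degrees_def)
  have 2: "has_path Q (Suc (Suc 0)) (blocks (if ?c Q then [1] else [0, 1]))" if "degrees 1 2 Q" for Q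
    using degrees_step[OF 1 that] by (cases "?c Q") (simp_all add: simps)
  have 3: "has_path Q (Suc (Suc (Suc 0))) (blocks (if ?c Q then [2] else [1]))" if "degrees 1 2 Q" for Q
    using degrees_step[OF 2 that] by (cases "?c Q") (simp_all add: simps)
  have 4: "has_path Q (Suc (Suc (Suc (Suc 0)))) [False]" if "degrees 1 2 Q" for Q
    using degrees_step[OF 3 that] by (cases "?c Q") (simp_all add: simps)
  have "\<exists>w. has_path Q n w" if "degrees 1 2 Q" "0 < n" "n \<le> Suc (Suc (Suc (Suc 0)))" for Q n
  proof -
    have "n = Suc 0 \<or> n = Suc (Suc 0) \<or> n = Suc (Suc (Suc 0)) \<or> n = Suc (Suc (Suc (Suc 0)))"
      using that by auto
    then show ?thesis using 1 2 3 4 that(1) by blast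
  qed
  then show ?thesis using finite_type[OF _ 4 assms] by blast
qed

text \<open>The path is v after 6 steps for both orders of the degrees, giving period 8, as for
  G_2.\<close>

lemma laurent_1_3:
  assumes "degrees 1 3 Q" "coeffs_in S Q"
  shows "F_prod Q n Y \<in> laurent S"
proof -
  let ?c = "\<lambda>Q :: nat \<Rightarrow> 'k poly. degree (Q (Suc 0)) = 1"
  note simps = mutate_path_simps blocks_simps eval_nat_numeral
  have 1: "has_path Q (Suc 0) (blocks (if ?c Q then [0] else [0]))" if "degrees 1 3 Q" for Q
    using that has_path_one by (simp add: degrees_def)
  have 2: "has_path Q (Suc (Suc 0)) (blocks (if ?c Q then [1] else [0, 0, 1]))" if "degrees 1 3 Q" for Q
    using degrees_step[OF 1 that] by (cases "?c Q") (simp_all add: simps)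
  have 3: "has_path Q (Suc (Suc (Suc 0))) (blocks (if ?c Q then [1, 2] else [0, 1]))"
    if "degrees 1 3 Q" for Q
    using degrees_step[OF 2 that] by (cases "?c Q") (simp_all add: simps)
  have 4: "has_path Q (Suc (Suc (Suc (Suc 0)))) (blocks (if ?c Q then [2] else [0, 1, 1]))"
    if "degrees 1 3 Q" for Q
    using degrees_step[OF 3 that] by (cases "?c Q") (simp_all add: simps)
  have 5: "has_path Q (Suc (Suc (Suc (Suc (Suc 0))))) (blocks (if ?c Q then [3] else [1]))"
    if "degrees 1 3 Q" for Q
    using degrees_step[OF 4 that] by (cases "?c Q") (simp_all add: simps)
  have 6: "has_path Q (Suc (Suc (Suc (Suc (Suc (Suc 0)))))) [False]" if "degrees 1 3 Q" for Q
    using degrees_step[OF 5 that] by (cases "?c Q") (simp_all add: simps)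
  have "\<exists>w. has_path Q n w"
    if "degrees 1 3 Q" "0 < n" "n \<le> Suc (Suc (Suc (Suc (Suc (Suc 0)))))" for Q n
  proof -
    have "n = Suc 0 \<or> n = Suc (Suc 0) \<or> n = Suc (Suc (Suc 0)) \<or> n = Suc (Suc (Suc (Suc 0))) \<or>
        n = Suc (Suc (Suc (Suc (Suc 0)))) \<or> n = Suc (Suc (Suc (Suc (Suc (Suc 0)))))"
      using that by auto
    then show ?thesis using 1 2 3 4 5 6 that(1) by blast
  qed
  then show ?thesis using finite_type[OF _ 6 assms] by blast
qed

subsection \<open>A constant polynomial\<close>

abbreviation W :: "'a set" where "W \<equiv> laurent_words X Y"

lemma W_basic: "1 \<in> W" "X \<in> W" "inverse X \<in> W" "Y \<in> W" "inverse Y \<in> W"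
  using laurent_words_ev[of "[]"] laurent_words_ev[of "[XP]"] laurent_words_ev[of "[XM]"]
    laurent_words_ev[of "[YP]"] laurent_words_ev[of "[YM]"] by simp_all

lemma W_inverse:
  assumes "w \<in> W"
  shows "inverse w \<in> W"
proof -
  obtain ws where w: "w = prod_list ws" and ws: "set ws \<subseteq> {X, inverse X, Y, inverse Y}"
    using assms unfolding laurent_words_def by blast
  have "prod_list ws \<noteq> 0 \<and> inverse (prod_list ws) \<in> W"
    using ws
  proof (induction ws)
    case (Cons v vs)
    then have "v \<noteq> 0" "inverse v \<in> W" using X_nz Y_nz W_basic by auto
    with Cons show ?case by (simp add: nonzero_inverse_mult_distrib laurent_words_mult)
  qed (simp add: W_basic)
  then show ?thesis using w by simp
qed

lemma W_power: "w \<in> W \<Longrightarrow> w ^ n \<in> W"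
  by (induction n) (simp_all add: W_basic laurent_words_mult)

lemmas W_intros = W_basic W_inverse W_power laurent_words_mult

lemma W_laurent: "semiring_set S \<Longrightarrow> w \<in> W \<Longrightarrow> w \<in> laurent S"
  using laurent_monomial[of 1 S w] by (simp add: semiring_set_def \<iota>_one)

lemma hom_W:
  assumes G: "fixing_hom G" "G X \<in> W" "G Y \<in> W" and w: "w \<in> W"
  shows "G w \<in> W"
proof -
  obtain ws where w: "w = prod_list ws" and ws: "set ws \<subseteq> {X, inverse X, Y, inverse Y}"
    using w unfolding laurent_words_def by blast
  have "G (prod_list ws) \<in> W"
    using ws
  proof (induction ws)
    case (Cons v vs)
    then have "G v \<in> W" using G by (auto simp: hom_inverse W_inverse)
    with Cons show ?case by (simp add: hom_mult[OF G(1)] laurent_words_mult)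
  qed (simp add: W_basic hom_one[OF G(1)])
  then show ?thesis using w by simp
qed

lemma hom_laurent:
  assumes G: "fixing_hom G" "G X \<in> W" "G Y \<in> W" and x: "x \<in> laurent S"
  shows "G x \<in> laurent S"
  using x
  by (rule laurent_map)
     (simp_all add: hom_add[OF G(1)] hom_mult[OF G(1)] hom_\<iota>[OF G(1)] laurent_monomial hom_W[OF G])

lemma poly_at_one: "poly_at \<iota> 1 z = 1"
  by (simp add: poly_at_def \<iota>_one)

lemma F_one: "fixing_hom (F \<iota> X Y 1)" "F \<iota> X Y 1 X = Z" "F \<iota> X Y 1 Y = inverse X"
  using F_hom[of 1] F_X[of 1] F_Y[of 1] by (simp_all add: poly_at_one)

lemma poly_at_reflect:
  assumes "coeff P 0 \<noteq> 0" "z \<noteq> 0"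
  shows "poly_at \<iota> (reflect_poly P) (inverse z) = inverse z ^ degree P * poly_at \<iota> P z"
proof -
  have "inverse z ^ degree P * z ^ i = inverse z ^ (degree P - i)" if "i \<le> degree P" for i
  proof -
    have "inverse z ^ degree P = inverse z ^ (degree P - i) * inverse z ^ i"
      using that by (simp flip: power_add)
    moreover have "inverse z ^ i * z ^ i = 1" using assms(2) by (simp add: power_inverse)
    ultimately show ?thesis by (simp add: mult.assoc)
  qed
  then have "inverse z ^ degree P * poly_at \<iota> P z = (\<Sum>i\<le>degree P. \<iota> (coeff P i) * inverse z ^ (degree P - i))"
    by (simp add: poly_at_def sum_distrib_left \<iota>_left[of "inverse z ^ degree P"])
  also have "\<dots> = (\<Sum>i\<le>degree P. \<iota> (coeff P (degree P - i)) * inverse z ^ i)"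
    by (rule sum.reindex_bij_witness[where i="\<lambda>i. degree P - i" and j="\<lambda>i. degree P - i"]) auto
  also have "\<dots> = poly_at \<iota> (reflect_poly P) (inverse z)"
    using assms by (simp add: poly_at_def coeff_reflect_poly)
  finally show ?thesis ..
qed

text \<open>With S the image of Y under \<open>F\<close>, conjugation gives Z (S Z^-1 S^-1) Z^-1, to
  which \<open>conj_Z\<close> applies.\<close>

lemma F_F_one_Z:
  assumes P: "P \<noteq> 0"
  shows "F \<iota> X Y P (F \<iota> X Y 1 Z) = Z * inverse Y * inverse Z"
proof -
  let ?S = "poly_at \<iota> P Y * inverse X"
  have S: "?S \<noteq> 0" using poly_at_nonzero[OF P] X_nz by simp
  have inv: "inverse (Z * ?S * inverse Z) = Z * inverse ?S * inverse Z"
    by (subst nonzero_inverse_mult_distrib, use S Z_nz in simp, use S Z_nz in simp,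
        subst nonzero_inverse_mult_distrib[OF Z_nz S]) (simp only: inverse_inverse_eq mult.assoc)
  have "F \<iota> X Y P (F \<iota> X Y 1 Z) = F \<iota> X Y P (Z * inverse X * inverse Z)"
    by (simp only: hom_conj[OF F_one(1)] F_one)
  also have "\<dots> = (Z * ?S * inverse Z) * inverse Z * inverse (Z * ?S * inverse Z)"
    by (simp only: hom_conj[OF F_hom[OF P]] hom_inverse[OF F_hom[OF P]] F_X[OF P] F_Y[OF P])
  also have "\<dots> = Z * (?S * inverse Z * ((inverse Z * Z) * inverse ?S)) * inverse Z"
    unfolding inv by (simp only: mult.assoc)
  also have "\<dots> = Z * (?S * inverse Z * inverse ?S) * inverse Z"
    unfolding left_inverse[OF Z_nz] by (simp only: mult_1_left)
  finally show ?thesis unfolding conj_Z(2)[OF P] .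
qed

text \<open>The reflected polynomial at Z^-1 is Z^-d P(Z), a conjugate of Y^-d P(Y). Its factor P(Y)
  cancels against the inverse from the other factor, leaving a word.\<close>

lemma F_F_one_F_reflect_Y:
  assumes P: "coeff P 0 \<noteq> 0"
  shows "F \<iota> X Y P (F \<iota> X Y 1 (F \<iota> X Y (reflect_poly P) Y)) \<in> W"
proof -
  have nz: "P \<noteq> 0" "reflect_poly P \<noteq> 0" using P by auto
  let ?p = "poly_at \<iota> P Y"
  have p0: "?p \<noteq> 0" by (rule poly_at_nonzero[OF nz(1)])
  have Zi: "inverse Z = X * inverse Y * inverse X"
    using X_nz Y_nz by (simp add: nonzero_inverse_mult_distrib mult.assoc)
  have pw: "inverse Z ^ n = X * inverse Y ^ n * inverse X" for n
    unfolding Zi using X_nz by (induction n) (simp_all add: mult.assoc cancel)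
  have "F \<iota> X Y P (F \<iota> X Y 1 (F \<iota> X Y (reflect_poly P) Y))
      = F \<iota> X Y P (poly_at \<iota> (reflect_poly P) (inverse X) * inverse Z)"
    by (simp only: F_Y[OF nz(2)] hom_mult[OF F_one(1)] hom_inverse[OF F_one(1)]
        hom_poly_at[OF F_one(1)] F_one)
  also have "\<dots> = poly_at \<iota> (reflect_poly P) (inverse Z) * inverse (Z * (?p * inverse X) * inverse Z)"
    by (simp only: hom_mult[OF F_hom[OF nz(1)]] hom_inverse[OF F_hom[OF nz(1)]]
        hom_poly_at[OF F_hom[OF nz(1)]] F_X[OF nz(1)] F_Y[OF nz(1)])
  also have "\<dots> = (X * inverse Y ^ degree P * inverse X) * (X * ?p * inverse X) *
      (Z * (X * inverse ?p) * inverse Z)"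
    unfolding poly_at_reflect[OF P Z_nz] pw poly_at_conj[OF X_nz]
    using p0 X_nz Y_nz by (simp add: nonzero_inverse_mult_distrib mult.assoc cancel)
  also have "\<dots> = X * inverse Y ^ degree P * (?p * Y * inverse ?p) * inverse Z"
    using X_nz by (simp only: mult.assoc cancel)
  also have "?p * Y * inverse ?p = Y" using p0 by (simp add: poly_at_commute mult.assoc)
  finally show ?thesis by (simp add: W_intros)
qed

lemma fixing_hom_comp: "fixing_hom G \<Longrightarrow> fixing_hom K \<Longrightarrow> fixing_hom (\<lambda>z. G (K z))"
  by (simp add: fixing_hom_def)

text \<open>Four consecutive automorphisms send X and Y to words and hence preserve Laurent
  elements. The sequence has period 4, so only n < 4 needs a direct computation, according to which
  polynomial is constant.\<close>

lemma laurent_deg_zero: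
  assumes Q: "alternating Q" and d: "degree (Q 0) = 0 \<or> degree (Q (Suc 0)) = 0" and S: "coeffs_in S Q"
  shows "F_prod Q n Y \<in> laurent S"
proof -
  have S': "semiring_set S" using S by (simp add: coeffs_in_def)
  note nz = alternating_nz[OF Q]
  let ?F = "\<lambda>k. F \<iota> X Y (Q k)"
  let ?G = "\<lambda>z. ?F 0 (?F (Suc 0) (?F (Suc (Suc 0)) (?F (Suc (Suc (Suc 0))) z)))"
  have G: "fixing_hom ?G" by (rule fixing_hom_comp[OF F_hom[OF nz] fixing_hom_comp[OF F_hom[OF nz]
          fixing_hom_comp[OF F_hom[OF nz] F_hom[OF nz]]]])
  have r: "Q (Suc (Suc k)) = reflect_poly (Q k)" "coeff (Q k) 0 \<noteq> 0" for k
    using alternating_reflect[OF Q] alternating_const[OF Q, of k] by auto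
  have one: "degree (Q k) = 0 \<Longrightarrow> Q k = 1 \<and> Q (Suc (Suc k)) = 1" for k
    using alternating_deg0[OF Q] alternating_degree[OF Q] by metis
  have poly: "poly_at \<iota> (Q k) (inverse X) \<in> laurent S" for k
    unfolding poly_at_def using S W_laurent[OF S']
    by (intro laurent_sum laurent_scale) (auto simp: coeffs_in_def W_intros)
  have main: "?G X \<in> W \<and> ?G Y \<in> W \<and> F_prod Q (Suc (Suc 0)) Y \<in> laurent S \<and>
      F_prod Q (Suc (Suc (Suc 0))) Y \<in> laurent S"
  proof (cases "degree (Q 0) = 0")
    case True
    then have Q02: "Q 0 = 1" "Q (Suc (Suc 0)) = 1" using one[of 0] by auto
    have W1: "F \<iota> X Y 1 w \<in> W" if "w \<in> W" for w
      using hom_W[OF F_one(1) _ _ that] by (simp add: F_one W_intros)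
    have "?G X \<in> W"
      unfolding Q02 F_X[OF nz] F_F_one_Z[OF nz] by (simp add: W1 W_intros)
    moreover have "?G Y \<in> W"
      unfolding Q02 r(1)[of "Suc 0"] by (rule W1[OF F_F_one_F_reflect_Y[OF r(2)]])
    moreover have "F_prod Q (Suc (Suc 0)) Y \<in> laurent S"
    proof -
      have "F_prod Q (Suc (Suc 0)) Y = poly_at \<iota> (Q (Suc 0)) (inverse X) * inverse Z"
        by (simp only: F_prod.simps Q02 F_Y[OF nz] hom_mult[OF F_one(1)] hom_inverse[OF F_one(1)]
            hom_poly_at[OF F_one(1)] F_one)
      then show ?thesis using laurent_mult_ev[OF poly] unfolding inverse_Z_ev by metis
    qed
    moreover have "F_prod Q (Suc (Suc (Suc 0))) Y \<in> laurent S"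
    proof -
      have "F_prod Q (Suc (Suc (Suc 0))) Y = F \<iota> X Y 1 (inverse Z)"
        by (simp only: F_prod.simps Q02 F_one hom_inverse[OF F_hom[OF nz]] F_X[OF nz])
      then show ?thesis using W_laurent[OF S' W1] by (simp add: W_intros)
    qed
    ultimately show ?thesis by blast
  next
    case False
    then have Q13: "Q (Suc 0) = 1" "Q (Suc (Suc (Suc 0))) = 1" using d one[of "Suc 0"] by auto
    let ?a = "Z * inverse Y * inverse Z" and ?b = "?F 0 (F \<iota> X Y 1 (?F (Suc (Suc 0)) Y))"
    have a: "?a \<in> W" by (simp add: W_intros)
    have b: "?b \<in> W" unfolding r(1)[of 0] by (rule F_F_one_F_reflect_Y[OF r(2)])
    have h: "fixing_hom (\<lambda>z. ?F 0 (F \<iota> X Y 1 z))" by (rule fixing_hom_comp[OF F_hom[OF nz] F_one(1)])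
    have "?G X = ?a * ?b * inverse ?a"
      unfolding Q13 F_one hom_conj[OF F_hom[OF nz]] F_X[OF nz] hom_conj[OF h] F_F_one_Z[OF nz] ..
    then have "?G X \<in> W" using a b by (simp add: W_intros)
    moreover have "?G Y = inverse ?a"
      unfolding Q13 F_one hom_inverse[OF F_hom[OF nz]] F_X[OF nz] hom_inverse[OF h] F_F_one_Z[OF nz] ..
    moreover have "F_prod Q (Suc (Suc 0)) Y = inverse Z"
      by (simp only: F_prod.simps Q13 F_one hom_inverse[OF F_hom[OF nz]] F_X[OF nz])
    moreover have "F_prod Q (Suc (Suc (Suc 0))) Y = ?b"
      by (simp only: F_prod.simps Q13)
    ultimately show ?thesis using a b W_laurent[OF S'] by (simp add: W_intros)
  qed
  have per: "Q (Suc (Suc (Suc (Suc k)))) = Q k" for k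
    using alternating_reflect[OF Q, of "Suc (Suc k)"] alternating_reflect'[OF Q, of k] by simp
  show ?thesis
  proof (induction n rule: less_induct)
    case (less n)
    consider "n = 0" | "n = Suc 0" | "n = Suc (Suc 0)" | "n = Suc (Suc (Suc 0))"
      | m where "n = Suc (Suc (Suc (Suc m)))"
      by (metis not0_implies_Suc)
    then show ?case
    proof cases
      case 1
      then show ?thesis using laurent_Y[OF S'] by simp
    next
      case 2
      then show ?thesis using has_path_laurent[OF S has_path_one[OF Q]] by simp
    next
      case 5
      have "F_prod Q n Y = ?G (F_prod Q m Y)"
        unfolding 5 F_prod_Suc per ..
      then show ?thesis using hom_laurent[OF G] main less 5 by simp
    qed (use main in auto)
  qed
qed

section \<open>Assembly over all pairs of degrees\<close>

lemma F_prod_Y_laurent: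
  assumes Q: "alternating Q" and S: "coeffs_in S Q"
  shows "F_prod Q n Y \<in> laurent S"
proof -
  let ?a = "degree (Q 0)" and ?b = "degree (Q (Suc 0))"
  have path: ?thesis if "\<And>n. \<exists>w. has_path Q (Suc n) w"
  proof (cases n)
    case 0
    then show ?thesis using laurent_Y S by (simp add: coeffs_in_def)
  next
    case (Suc k)
    then show ?thesis using that[of k] has_path_laurent[OF S] by blast
  qed
  consider "?a = 0 \<or> ?b = 0" | "2 \<le> ?a" "2 \<le> ?b" | "?a = 1 \<and> 4 \<le> ?b \<or> 4 \<le> ?a \<and> ?b = 1"
    | "degrees 1 1 Q" | "degrees 1 2 Q" | "degrees 1 3 Q"
  proof -
    have "d = 0 \<or> d = 1 \<or> d = 2 \<or> d = 3 \<or> 4 \<le> d" for d :: nat by linarith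
    from this[of ?a] this[of ?b] show ?thesis
      using Q that unfolding degrees_def by (elim disjE) simp_all
  qed
  then show ?thesis
  proof cases
    case 1
    then show ?thesis using laurent_deg_zero[OF Q _ S] by simp
  next
    case 2
    then show ?thesis using has_path_ge2[OF Q] path by metis
  next
    case 3
    then show ?thesis using has_path_one_four[OF Q 3] path by metis
  next
    case 4
    then show ?thesis using laurent_1_1[OF _ S] by simp
  next
    case 5
    then show ?thesis using laurent_1_2[OF _ S] by simp
  next
    case 6
    then show ?thesis using laurent_1_3[OF _ S] by simp
  qed
qed

text \<open>The innermost automorphism sends X to Z = C Y, and the others fix C; this reduces X to Y
  with one step fewer.\<close>

lemma F_prod_X_laurent:
  assumes Q: "alternating Q" and S: "coeffs_in S Q"
  shows "F_prod Q n X \<in> laurent S"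
proof (cases n)
  case 0
  then show ?thesis using S laurent_ev[of S "[XP]"] by (simp add: coeffs_in_def)
next
  case (Suc k)
  have "F_prod Q k (C * z) = C * F_prod Q k z" for z
    by (induction k arbitrary: z)
      (simp_all only: F_prod.simps hom_mult[of "F \<iota> X Y _" C, OF F_hom[OF alternating_nz[OF Q]]]
        F_C[OF alternating_nz[OF Q]])
  moreover have "C * Y = Z" using Y_nz by (simp add: mult.assoc)
  ultimately have "F_prod Q n X = C * F_prod Q k Y"
    unfolding Suc F_prod.simps F_X[OF alternating_nz[OF Q]] by metis
  then show ?thesis using laurent_ev_mult[OF F_prod_Y_laurent[OF Q S]] unfolding C_ev by metis
qed

end

section \<open>The coefficient semiring and the given polynomials\<close>

lemma semiring_set_A_plus:
  "0 \<in> A_plus P1 P2 \<and> 1 \<in> A_plus P1 P2 \<and>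
    (\<forall>a\<in>A_plus P1 P2. \<forall>b\<in>A_plus P1 P2. a + b \<in> A_plus P1 P2 \<and> a * b \<in> A_plus P1 P2)"
  by (auto intro: A_plus.intros)

lemma coeff_in_A_plus: "coeff P1 i \<in> A_plus P1 P2" "coeff P2 i \<in> A_plus P1 P2"
proof -
  show "coeff P1 i \<in> A_plus P1 P2"
    by (cases "i \<le> degree P1") (auto intro: A_plus.intros simp: coeff_eq_0)
  show "coeff P2 i \<in> A_plus P1 P2"
    by (cases "i \<le> degree P2") (auto intro: A_plus.intros simp: coeff_eq_0)
qed

theorem mainTheorem1:
  fixes \<iota> :: "'k::field_char_0 \<Rightarrow> 'a::division_ring"
    and X Y :: 'a
    and P1 P2 :: "'k poly"
    and m :: nat
  assumes "free_skew_field \<iota> X Y"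
    and "lead_coeff P1 = 1" and "poly P1 0 = 1"
    and "lead_coeff P2 = 1" and "poly P2 0 = 1"
  shows "F_comp \<iota> X Y P1 P2 m X \<in> laurent_semiring \<iota> (A_plus P1 P2) X Y
       \<and> F_comp \<iota> X Y P1 P2 m Y \<in> laurent_semiring \<iota> (A_plus P1 P2) X Y"
proof -
  interpret free_generators \<iota> X Y by unfold_locales (rule assms(1))
  \<comment> \<open>The index moves by one, since the product of the automorphisms starts with
    P_1.\<close>
  let ?Q = "\<lambda>k. P_seq P1 P2 (int (Suc k))"
  have c: "coeff P1 0 = 1" "coeff P2 0 = 1" using assms(3,5) by (simp_all add: poly_0_coeff_0)
  have "?Q (k + 2) = reflect_poly (?Q k)" for k
  proof -
    have "int (Suc (k + 2)) mod 4 = (int (Suc k) mod 4 + 2) mod 4" by presburger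
    moreover have "int (Suc k) mod 4 = 0 \<or> int (Suc k) mod 4 = 1 \<or> int (Suc k) mod 4 = 2 \<or>
        int (Suc k) mod 4 = 3" by presburger
    ultimately show ?thesis using c unfolding P_seq_def by (elim disjE) simp_all
  qed
  \<comment> \<open>For the reflected polynomials the constant term is the leading coefficient, so
    monicity enters here.\<close>
  moreover have "coeff (P_seq P1 P2 k) 0 = 1" for k
    using c assms(2,4) by (auto simp: P_seq_def coeff_reflect_poly)
  ultimately have "alternating ?Q" by (simp add: alternating_def)
  moreover have "coeffs_in (A_plus P1 P2) ?Q"
    unfolding coeffs_in_def semiring_set_def using semiring_set_A_plus[of P1 P2]
    by (auto simp: P_seq_def coeff_reflect_poly coeff_in_A_plus)
  moreover have "F_comp \<iota> X Y P1 P2 n z = F_prod ?Q n z" for n z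
    by (induction n arbitrary: z) simp_all
  ultimately show ?thesis
    using F_prod_X_laurent F_prod_Y_laurent unfolding laurent_def by metis
qed

end
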